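(* Let $H\in(1/2,1)$, $\kappa,\lambda>0$, $g=(g_i)_{i\in\mathbb{Z}}\in\ell^2$, $\sigma=(\sigma_i)_{i\in\mathbb{Z}}\in\ell^2$, and let $f_i:\mathbb{R}\to\mathbb{R}$ ($i\in\mathbb{Z}$) be continuously differentiable functions such that $f(x)=(f_i(x_i))_{i\in\mathbb{Z}}$ maps $\ell^2$ into $\ell^2$. Assume that there are constants $L>0$, $K>0$, $p\ge 1$ with $$\langle x-y, f(x)-f(y)\rangle\le -L|x-y|^2\quad\text{for all }x,y\in\ell^2,\qquad |f(x)|+|Df(x)|\le K(1+|x|^p)\quad\text{for all }x\in\ell^2 .$$ Let $\varphi:\mathbb{R}^+\times\Omega\times\ell^2\to\ell^2$ be the continuous random dynamical system over $(\Omega,\mathcal{F},\mathbb{P},(\theta_t)_{t\in\mathbb{R}})$ given by $\varphi(t,\omega,u_0)=u(t)$, where $u$ is the unique pathwise solution of $$u(t)=u_0+\int_0^t\bigl(-\kappa Au(s)-\lambda u(s)+f(u(s))+g\bigr)\,ds+W(t,\omega),\qquad t\ge 0 .$$ Then $\varphi$ has a unique random attractor $\mathcal{A}=\{\mathcal{A}(\omega)\}_{\omega\in\Omega}$ (with respect to the universe of tempered random sets). Furthermore, this random attractor is in fact a singleton sets random attractor, i.e. $\mathcal{A}(\omega)=\{\tilde u_0(\omega)\}$ for some random variable $\tilde u_0:\Omega\to\ell^2$.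
   Context: $\ell^2=\ell^2(\mathbb{Z})$ is the real Hilbert space of square-summable sequences with inner product $\langle\cdot,\cdot\rangle$ and norm $|\cdot|$; $e^i\in\ell^2$ is the element with 1 at position $i$ and 0 elsewhere. $A:\ell^2\to\ell^2$ is the linear operator $(Ax)_i=-x_{i-1}+2x_i-x_{i+1}$. $Df$ is the derivative of $f$. Noise. A two-sided one-dimensional fractional Brownian motion (fBm) with Hurst parameter $H$ is a continuous centered Gaussian process $\beta^H(t)$, $t\in\mathbb{R}$, with $\mathbf{E}\,\beta^H(t)\beta^H(s)=\frac12(|t|^{2H}+|s|^{2H}-|t-s|^{2H})$. The canonical interpretation is used: $\Omega=C_0(\mathbb{R},\ell^2)$ is the space of continuous functions $\omega:\mathbb{R}\to\ell^2$ with $\omega(0)=0$, equipped with the compact open topology; $\mathcal{F}$ is its Borel $\sigma$-algebra; $\mathbb{P}$ is the distribution of the fBm, with $\beta^H(\cdot,\omega)=\omega(\cdot)$ and coordinates $\omega_i=\beta_i^H$, $i\in\mathbb{Z}$, independent two-sided fBms with Hurst parameter $H$; and $(\theta_t\omega)(\cdot)=\omega(\cdot+t)-\omega(t)$, $t\in\mathbb{R}$, so that $(\Omega,\mathcal{F},\mathbb{P},(\theta_t)_{t\in\mathbb{R}})$ is an ergodic metric dynamical system. The noise is $W(t,\omega)=\sum_{i\in\mathbb{Z}}\sigma_i\omega_i(t)e^i$. The metric dynamical system is restricted (keeping the same symbols, with the trace $\sigma$-algebra) to a $(\theta_t)$-invariant set of full measure on which $|W(t,\omega)|\le\rho(\omega)(1+|t|^2)$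 for all $t\in\mathbb{R}$, for some random constant $\rho(\omega)>0$. Random dynamical system. A continuous random dynamical system on a separable Hilbert space $\mathbb{E}$ (here $\mathbb{E}=\ell^2$) over $(\Omega,\mathcal{F},\mathbb{P},(\theta_t)_{t\in\mathbb{R}})$ is a measurable map $\varphi:\mathbb{R}^+\times\Omega\times\mathbb{E}\to\mathbb{E}$ such that $\varphi(0,\omega,\cdot)=\mathrm{id}$, $\varphi(t+s,\omega,\cdot)=\varphi(t,\theta_s\omega,\cdot)\circ\varphi(s,\omega,\cdot)$ for all $s,t\in\mathbb{R}^+$, $\omega\in\Omega$, and $\varphi(t,\omega,\cdot)$ is continuous on $\mathbb{E}$ for all $(t,\omega)$. Tempered sets. A random variable $r:\Omega\to\mathbb{R}$ is tempered if $\lim_{t\to\pm\infty}\frac{\log|r(\theta_t\omega)|}{|t|}=0$ $\mathbb{P}$-a.s.; a random set $D=\{D(\omega)\}_{\omega\in\Omega}$ of nonempty subsets of $\mathbb{E}$ is tempered if $D(\omega)\subset\{x\in\mathbb{E}:\|x\|\le r(\omega)\}$ for a tempered random variable $r$. The attracting universe $\mathcal{D}$ consists of the tempered random sets. Random attractor. A family $\mathcal{A}=\{\mathcal{A}(\omega)\}_{\omega\in\Omega}$ of nonempty measurable compact subsets of $\mathbb{E}$ is a random attractor of $\varphi$ if it is $\varphi$-invariant, i.e. $\varphi(t,\omega,\mathcal{A}(\omega))=\mathcal{A}(\theta_t\omega)$ for all $t\in\mathbb{R}^+$, and pathwise pullback attracting: $H_d^*(\varphi(t,\theta_{-t}\omega,D(\theta_{-t}\omega)),\mathcal{A}(\omega))\to0$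 as $t\to\infty$ for all $D\in\mathcal{D}$, where $H_d^*(X,Y)=\sup_{x\in X}\inf_{y\in Y}\|x-y\|$ is the Hausdorff semi-distance on $\mathbb{E}$.
   Formalization: Noise paths lie in C_0(R,R^Z), not C_0(R,l^2), where independent identically distributed fBm coordinates cannot exist; pullback attraction and uniqueness hold almost surely, since both fail at every ω on null orbits when temperedness is only almost sure and attractors need not be tempered. *)

theory Defs
  imports "HOL-Probability.Probability"
begin

section \<open>The separable real Hilbert space of square-summable sequences indexed by the integers\<close>

lemma summable_on_shift_int:
  fixes x :: "int \<Rightarrow> real"
  assumes "(\<lambda>i. (x i)\<^sup>2) summable_on UNIV"
  shows "(\<lambda>i. (x (i + k))\<^sup>2) summable_on UNIV"
proof -
  have "bij_betw (\<lambda>i. i + k) UNIV (UNIV :: int set)"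
    by (rule bij_betw_byWitness[where f' = "\<lambda>i. i - k"]) auto
  from summable_on_reindex_bij_betw[OF this, of "\<lambda>i. (x i)\<^sup>2"] assms show ?thesis
    by simp
qed

lemma square_summable_add:
  fixes x y :: "int \<Rightarrow> real"
  assumes "(\<lambda>i. (x i)\<^sup>2) summable_on UNIV" "(\<lambda>i. (y i)\<^sup>2) summable_on UNIV"
  shows "(\<lambda>i. (x i + y i)\<^sup>2) summable_on UNIV"
proof (rule summable_on_comparison_test)
  show "(\<lambda>i. 2 * ((x i)\<^sup>2 + (y i)\<^sup>2)) summable_on UNIV"
    by (intro summable_on_cmult_right summable_on_add assms)
  show "(x i + y i)\<^sup>2 \<le> 2 * ((x i)\<^sup>2 + (y i)\<^sup>2)" for i
    using sum_squares_ge_zero[of "x i - y i" 0] by (simp add: power2_eq_square algebra_simps)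
qed auto

lemma square_summable_scale:
  fixes x :: "int \<Rightarrow> real"
  assumes "(\<lambda>i. (x i)\<^sup>2) summable_on UNIV"
  shows "(\<lambda>i. (c * x i)\<^sup>2) summable_on UNIV"
  unfolding power_mult_distrib by (intro summable_on_cmult_right assms)

lemma square_summable_mult:
  fixes x y :: "int \<Rightarrow> real"
  assumes "(\<lambda>i. (x i)\<^sup>2) summable_on UNIV" "(\<lambda>i. (y i)\<^sup>2) summable_on UNIV"
  shows "(\<lambda>i. x i * y i) summable_on UNIV"
proof -
  have *: "(\<lambda>i. ((x i + y i)\<^sup>2 + (-1) * ((x i)\<^sup>2 + (y i)\<^sup>2)) * (1/2)) summable_on UNIV"
    by (intro summable_on_cmult_left summable_on_add summable_on_cmult_right square_summable_add assms)
  have "(\<lambda>i. ((x i + y i)\<^sup>2 + (-1) * ((x i)\<^sup>2 + (y i)\<^sup>2)) * (1/2)) = (\<lambda>i. x i * y i)"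
    by (simp add: fun_eq_iff power2_eq_square algebra_simps)
  with * show ?thesis by simp
qed

typedef ell2 = "{x :: int \<Rightarrow> real. (\<lambda>i. (x i)\<^sup>2) summable_on UNIV}"
  morphisms ell2_nth Abs_ell2
  by (rule exI[of _ "\<lambda>_. 0"]) simp

setup_lifting type_definition_ell2

lemma ell2_nth_summable: "(\<lambda>i. (ell2_nth x i)\<^sup>2) summable_on UNIV"
  using ell2_nth[of x] by simp

lemma ell2_eqI: "(\<And>i. ell2_nth x i = ell2_nth y i) \<Longrightarrow> x = y"
  by (simp add: ell2_nth_inject[symmetric] fun_eq_iff)

instantiation ell2 :: real_vector
begin

lift_definition zero_ell2 :: ell2 is "\<lambda>_. 0" by simp
lift_definition plus_ell2 :: "ell2 \<Rightarrow> ell2 \<Rightarrow> ell2" is "\<lambda>x y i. x i + y i"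
  by (rule square_summable_add)
lift_definition uminus_ell2 :: "ell2 \<Rightarrow> ell2" is "\<lambda>x i. - x i" by simp
lift_definition minus_ell2 :: "ell2 \<Rightarrow> ell2 \<Rightarrow> ell2" is "\<lambda>x y i. x i - y i"
  using square_summable_add[of _ "\<lambda>i. - _ i"] by simp
lift_definition scaleR_ell2 :: "real \<Rightarrow> ell2 \<Rightarrow> ell2" is "\<lambda>c x i. c * x i"
  by (rule square_summable_scale)

instance
  by standard (transfer; simp add: fun_eq_iff algebra_simps)+

end

instantiation ell2 :: real_inner
begin

definition inner_ell2 :: "ell2 \<Rightarrow> ell2 \<Rightarrow> real"
  where "inner_ell2 x y = (\<Sum>\<^sub>\<infinity>i. ell2_nth x i * ell2_nth y i)"
definition norm_ell2 :: "ell2 \<Rightarrow> real"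
  where "norm_ell2 x = sqrt (inner x x)"
definition dist_ell2 :: "ell2 \<Rightarrow> ell2 \<Rightarrow> real"
  where "dist_ell2 x y = norm (x - y)"
definition sgn_ell2 :: "ell2 \<Rightarrow> ell2"
  where "sgn_ell2 x = x /\<^sub>R norm x"
definition uniformity_ell2 :: "(ell2 \<times> ell2) filter"
  where "uniformity_ell2 = (INF e\<in>{0<..}. principal {(x, y). dist x y < e})"
definition open_ell2 :: "ell2 set \<Rightarrow> bool"
  where "open_ell2 U = (\<forall>x\<in>U. eventually (\<lambda>(x', y). x' = x \<longrightarrow> y \<in> U) uniformity)"

instance
proof
  fix x y z :: ell2 and r :: real
  note S = square_summable_mult[OF ell2_nth_summable ell2_nth_summable]
  show "inner x y = inner y x"
    by (simp add: inner_ell2_def mult.commute)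
  show "inner (x + y) z = inner x z + inner y z"
    unfolding inner_ell2_def plus_ell2.rep_eq distrib_right by (intro infsum_add S)
  show "inner (r *\<^sub>R x) y = r * inner x y"
    unfolding inner_ell2_def scaleR_ell2.rep_eq mult.assoc by (intro infsum_cmult_right S)
  show "0 \<le> inner x x"
    unfolding inner_ell2_def by (intro infsum_nonneg) auto
  show "inner x x = 0 \<longleftrightarrow> x = 0"
  proof
    assume "inner x x = 0"
    then have "ell2_nth x i * ell2_nth x i = 0" for i
      unfolding inner_ell2_def
      by (intro nonneg_infsum_le_0D[where A = UNIV and f = "\<lambda>i. ell2_nth x i * ell2_nth x i"] S) auto
    then show "x = 0" by (intro ell2_eqI) (simp add: zero_ell2.rep_eq)
  qed (simp add: inner_ell2_def zero_ell2.rep_eq)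
qed (simp_all add: dist_ell2_def sgn_ell2_def norm_ell2_def uniformity_ell2_def open_ell2_def)

end

lemma ell2_power2_norm: "(norm x)\<^sup>2 = (\<Sum>\<^sub>\<infinity>i. (ell2_nth x i)\<^sup>2)"
  by (simp only: power2_norm_eq_inner inner_ell2_def) (simp add: power2_eq_square)

lemma ell2_finite_sum_le: "finite F \<Longrightarrow> (\<Sum>i\<in>F. (ell2_nth x i)\<^sup>2) \<le> (norm x)\<^sup>2"
  unfolding ell2_power2_norm by (intro finite_sum_le_infsum ell2_nth_summable) auto

lemma ell2_abs_nth_le: "\<bar>ell2_nth x i\<bar> \<le> norm x"
  using ell2_finite_sum_le[of "{i}" x] by (simp add: abs_le_square_iff[symmetric])

lemma ell2_norm_le:
  assumes "0 \<le> c" "\<And>F. finite F \<Longrightarrow> (\<Sum>i\<in>F. (ell2_nth x i)\<^sup>2) \<le> c\<^sup>2"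
  shows "norm x \<le> c"
proof -
  have "(norm x)\<^sup>2 \<le> c\<^sup>2"
    unfolding ell2_power2_norm by (intro infsum_le_finite_sums ell2_nth_summable assms) auto
  then show ?thesis using assms(1) by (rule power2_le_imp_le)
qed

lemma square_summableI:
  fixes x :: "int \<Rightarrow> real"
  assumes "\<And>F. finite F \<Longrightarrow> (\<Sum>i\<in>F. (x i)\<^sup>2) \<le> c"
  shows "(\<lambda>i. (x i)\<^sup>2) summable_on UNIV"
  by (rule nonneg_bdd_above_summable_on) (auto intro!: bdd_aboveI2[where M = c] assms)

instance ell2 :: complete_space
proof
  fix X :: "nat \<Rightarrow> ell2" assume X: "Cauchy X"
  have "Cauchy (\<lambda>n. ell2_nth (X n) i)" for i
  proof (rule metric_CauchyI)
    fix e :: real assume "0 < e"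
    with X obtain N where N: "\<And>m n. m \<ge> N \<Longrightarrow> n \<ge> N \<Longrightarrow> dist (X m) (X n) < e"
      by (metis Cauchy_def)
    have "dist (ell2_nth (X m) i) (ell2_nth (X n) i) < e" if "m \<ge> N" "n \<ge> N" for m n
      using ell2_abs_nth_le[of "X m - X n" i] N[OF that]
      by (simp add: dist_norm minus_ell2.rep_eq)
    then show "\<exists>N. \<forall>m\<ge>N. \<forall>n\<ge>N. dist (ell2_nth (X m) i) (ell2_nth (X n) i) < e" by blast
  qed
  then have "\<forall>i. \<exists>l. (\<lambda>n. ell2_nth (X n) i) \<longlonglongrightarrow> l"
    by (simp add: Cauchy_convergent_iff convergent_def)
  then obtain l where l: "\<And>i. (\<lambda>n. ell2_nth (X n) i) \<longlonglongrightarrow> l i" by metis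
  have tail: "(\<Sum>i\<in>F. (ell2_nth (X m) i - l i)\<^sup>2) \<le> e\<^sup>2"
    if F: "finite F" and N: "\<And>n. n \<ge> N \<Longrightarrow> dist (X m) (X n) < e" for F m N e
  proof (rule LIMSEQ_le_const2)
    show "(\<lambda>n. \<Sum>i\<in>F. (ell2_nth (X m) i - ell2_nth (X n) i)\<^sup>2) \<longlonglongrightarrow> (\<Sum>i\<in>F. (ell2_nth (X m) i - l i)\<^sup>2)"
      by (intro tendsto_intros l)
    have "(\<Sum>i\<in>F. (ell2_nth (X m) i - ell2_nth (X n) i)\<^sup>2) \<le> e\<^sup>2" if "n \<ge> N" for n
    proof -
      have "(\<Sum>i\<in>F. (ell2_nth (X m - X n) i)\<^sup>2) \<le> (norm (X m - X n))\<^sup>2"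
        by (rule ell2_finite_sum_le[OF F])
      also have "\<dots> \<le> e\<^sup>2"
        using N[OF that] by (intro power_mono) (auto simp: dist_norm)
      finally show ?thesis by (simp add: minus_ell2.rep_eq)
    qed
    then show "\<exists>N. \<forall>n\<ge>N. (\<Sum>i\<in>F. (ell2_nth (X m) i - ell2_nth (X n) i)\<^sup>2) \<le> e\<^sup>2" by blast
  qed
  obtain N1 where N1: "\<And>m n. m \<ge> N1 \<Longrightarrow> n \<ge> N1 \<Longrightarrow> dist (X m) (X n) < 1"
    using X zero_less_one by (metis Cauchy_def)
  have "(\<lambda>i. (ell2_nth (X N1) i - l i)\<^sup>2) summable_on UNIV"
    by (rule square_summableI[of _ "1\<^sup>2"]) (rule tail, use N1 in auto)
  then have "(\<lambda>i. ((-1) * (ell2_nth (X N1) i - l i) + ell2_nth (X N1) i)\<^sup>2) summable_on UNIV"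
    by (intro square_summable_add square_summable_scale ell2_nth_summable)
  then have lsum: "(\<lambda>i. (l i)\<^sup>2) summable_on UNIV"
    by simp
  then have nthL: "ell2_nth (Abs_ell2 l) = l"
    by (simp add: Abs_ell2_inverse)
  have "X \<longlonglongrightarrow> Abs_ell2 l"
  proof (rule LIMSEQ_I)
    fix r :: real assume "0 < r"
    then have r2: "0 < r / 2" by simp
    with X obtain N where N: "\<And>m n. m \<ge> N \<Longrightarrow> n \<ge> N \<Longrightarrow> dist (X m) (X n) < r / 2"
      by (metis Cauchy_def)
    have "norm (X m - Abs_ell2 l) < r" if "m \<ge> N" for m
    proof -
      have "norm (X m - Abs_ell2 l) \<le> r / 2"
      proof (rule ell2_norm_le)
        show "(\<Sum>i\<in>F. (ell2_nth (X m - Abs_ell2 l) i)\<^sup>2) \<le> (r / 2)\<^sup>2" if "finite F" for F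
          unfolding minus_ell2.rep_eq nthL
          by (rule tail[OF that, where N = N]) (use N \<open>m \<ge> N\<close> in auto)
      qed (use r2 in simp)
      then show ?thesis using \<open>0 < r\<close> by simp
    qed
    then show "\<exists>no. \<forall>n\<ge>no. norm (X n - Abs_ell2 l) < r" by blast
  qed
  then show "convergent X" by (rule convergentI)
qed

lift_definition ell2_unit :: "int \<Rightarrow> ell2" is "\<lambda>i j. if j = i then 1 else 0"
proof -
  fix i :: int
  show "(\<lambda>j. (if j = i then 1 else 0 :: real)\<^sup>2) summable_on UNIV"
    by (rule square_summableI[of _ 1]) (simp add: if_distrib[where f = "\<lambda>z. z\<^sup>2"] cong: if_cong)
qed

lemma ell2_nth_sum: "ell2_nth (\<Sum>j\<in>F. h j) i = (\<Sum>j\<in>F. ell2_nth (h j) i)"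
  by (induction F rule: infinite_finite_induct) (auto simp: zero_ell2.rep_eq plus_ell2.rep_eq)

lemma ell2_nth_sum_unit:
  "finite F \<Longrightarrow> ell2_nth (\<Sum>j\<in>F. c j *\<^sub>R ell2_unit j) i = (if i \<in> F then c i else 0)"
  by (simp add: ell2_nth_sum scaleR_ell2.rep_eq ell2_unit.rep_eq if_distrib cong: if_cong)

lemma norm_ell2_unit: "norm (ell2_unit i) = 1"
proof -
  have "(\<Sum>\<^sub>\<infinity>j. (ell2_nth (ell2_unit i) j)\<^sup>2) = (\<Sum>\<^sub>\<infinity>j\<in>{i}. 1)"
    by (rule infsum_cong_neutral) (auto simp: ell2_unit.rep_eq)
  then have "(norm (ell2_unit i))\<^sup>2 = 1\<^sup>2" by (simp add: ell2_power2_norm)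
  then show ?thesis by (simp only: power2_eq_iff_nonneg norm_ge_zero zero_le_one)
qed

lemma ell2_has_sum_unit: "((\<lambda>i. ell2_nth x i *\<^sub>R ell2_unit i) has_sum x) UNIV"
  unfolding has_sum_def
proof (rule tendstoI)
  fix e :: real assume e: "0 < e"
  have hs: "((\<lambda>i. (ell2_nth x i)\<^sup>2) has_sum (norm x)\<^sup>2) UNIV"
    unfolding ell2_power2_norm by (rule has_sum_infsum[OF ell2_nth_summable])
  then have "((sum (\<lambda>i. (ell2_nth x i)\<^sup>2)) \<longlongrightarrow> (norm x)\<^sup>2) (finite_subsets_at_top UNIV)"
    by (simp add: has_sum_def)
  then have "\<forall>\<^sub>F F in finite_subsets_at_top UNIV. dist (\<Sum>i\<in>F. (ell2_nth x i)\<^sup>2) ((norm x)\<^sup>2) < (e / 2)\<^sup>2"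
    by (rule tendstoD) (use e in simp)
  moreover have "\<forall>\<^sub>F F in finite_subsets_at_top (UNIV :: int set). finite F"
    by (rule eventually_finite_subsets_at_top_weakI)
  ultimately show "\<forall>\<^sub>F F in finite_subsets_at_top UNIV.
      dist (\<Sum>i\<in>F. ell2_nth x i *\<^sub>R ell2_unit i) x < e"
  proof eventually_elim
    case (elim F)
    have "norm ((\<Sum>i\<in>F. ell2_nth x i *\<^sub>R ell2_unit i) - x) \<le> e / 2"
    proof (rule ell2_norm_le)
      fix G :: "int set" assume G: "finite G"
      have "(\<Sum>i\<in>G. (ell2_nth ((\<Sum>i\<in>F. ell2_nth x i *\<^sub>R ell2_unit i) - x) i)\<^sup>2)
          = (\<Sum>i\<in>G. if i \<in> F then 0 else (ell2_nth x i)\<^sup>2)"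
        using elim by (intro sum.cong) (auto simp: minus_ell2.rep_eq ell2_nth_sum_unit)
      also have "\<dots> = (\<Sum>i\<in>G - F. (ell2_nth x i)\<^sup>2)"
        using G by (intro sum.mono_neutral_cong_right) auto
      also have "\<dots> = (\<Sum>i\<in>G \<union> F. (ell2_nth x i)\<^sup>2) - (\<Sum>i\<in>F. (ell2_nth x i)\<^sup>2)"
        using sum_diff[of "G \<union> F" F "\<lambda>i. (ell2_nth x i)\<^sup>2"] G elim
        by (simp add: Un_Diff)
      also have "\<dots> \<le> (norm x)\<^sup>2 - (\<Sum>i\<in>F. (ell2_nth x i)\<^sup>2)"
        using ell2_finite_sum_le[of "G \<union> F" x] G elim by simp
      also have "\<dots> \<le> (e / 2)\<^sup>2"
        using elim by (simp add: dist_real_def)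
      finally show "(\<Sum>i\<in>G. (ell2_nth ((\<Sum>i\<in>F. ell2_nth x i *\<^sub>R ell2_unit i) - x) i)\<^sup>2) \<le> (e / 2)\<^sup>2" .
    qed (use e in simp)
    then show ?case using e by (simp add: dist_norm)
  qed
qed

lemma ell2_countable_dense:
  "\<exists>D :: ell2 set. countable D \<and> (\<forall>x. \<forall>e>0. \<exists>d\<in>D. dist d x < e)"
proof (intro exI conjI allI impI)
  let ?D = "(\<lambda>xs. \<Sum>(i, q)\<leftarrow>xs. real_of_rat q *\<^sub>R ell2_unit i) ` (UNIV :: (int \<times> rat) list set)"
  show "countable ?D" by simp
  fix x :: ell2 and e :: real assume e: "0 < e"
  have "\<forall>\<^sub>F F in finite_subsets_at_top UNIV. dist (\<Sum>i\<in>F. ell2_nth x i *\<^sub>R ell2_unit i) x < e / 2"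
    using ell2_has_sum_unit[of x] e unfolding has_sum_def by (intro tendstoD) auto
  then obtain F where F: "finite F" "dist (\<Sum>i\<in>F. ell2_nth x i *\<^sub>R ell2_unit i) x < e / 2"
    unfolding eventually_finite_subsets_at_top by blast
  define \<delta> where "\<delta> = e / (2 * (real (card F) + 1))"
  have \<delta>: "0 < \<delta>" using e by (simp add: \<delta>_def)
  have "\<exists>q. \<bar>real_of_rat q - ell2_nth x i\<bar> < \<delta>" for i
  proof -
    obtain r where r: "r \<in> \<rat>" "ell2_nth x i < r" "r < ell2_nth x i + \<delta>"
      using Rats_dense_in_real[of "ell2_nth x i" "ell2_nth x i + \<delta>"] \<delta> by auto
    then obtain q where "r = real_of_rat q" by (auto elim!: Rats_cases)
    with r show ?thesis by (intro exI[of _ q]) simp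
  qed
  then obtain q where q: "\<And>i. \<bar>real_of_rat (q i) - ell2_nth x i\<bar> < \<delta>" by metis
  obtain xs where xs: "set xs = F" "distinct xs" using F(1) finite_distinct_list by blast
  define d where "d = (\<Sum>i\<in>F. real_of_rat (q i) *\<^sub>R ell2_unit i)"
  have "d = (\<Sum>(i, q)\<leftarrow>map (\<lambda>i. (i, q i)) xs. real_of_rat q *\<^sub>R ell2_unit i)"
    unfolding d_def xs(1)[symmetric] using xs(2)
    by (simp add: sum_list_distinct_conv_sum_set o_def)
  then have dD: "d \<in> ?D" by blast
  have "dist d (\<Sum>i\<in>F. ell2_nth x i *\<^sub>R ell2_unit i)
      = norm (\<Sum>i\<in>F. (real_of_rat (q i) - ell2_nth x i) *\<^sub>R ell2_unit i)"
    by (simp add: d_def dist_norm sum_subtractf scaleR_left_diff_distrib)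
  also have "\<dots> \<le> (\<Sum>i\<in>F. \<delta>)"
    by (rule sum_norm_le) (use q in \<open>simp add: norm_ell2_unit less_imp_le\<close>)
  also have "\<dots> \<le> e / 2"
  proof -
    have "real (card F) * (e / (2 * (real (card F) + 1))) = (e / 2) * (real (card F) / (real (card F) + 1))"
      by simp
    also have "\<dots> \<le> (e / 2) * 1"
      using e by (intro mult_left_mono) auto
    finally show ?thesis by (simp add: \<delta>_def)
  qed
  finally have "dist d x < e"
    using F(2) dist_triangle[of d x "\<Sum>i\<in>F. ell2_nth x i *\<^sub>R ell2_unit i"] by simp
  with dD show "\<exists>d\<in>?D. dist d x < e" by blast
qed

instance ell2 :: polish_space
proof
  obtain D :: "ell2 set" where D: "countable D" "\<And>x e. 0 < e \<Longrightarrow> \<exists>d\<in>D. dist d x < e"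
    using ell2_countable_dense by blast
  let ?B = "(\<lambda>(d, n). ball d (1 / real (Suc n))) ` (D \<times> (UNIV :: nat set))"
  have "topological_basis ?B"
  proof (rule topological_basisI)
    fix U :: "ell2 set" and x assume "open U" "x \<in> U"
    then obtain e where e: "0 < e" "ball x e \<subseteq> U" by (meson openE)
    obtain n where n: "1 / real (Suc n) < e / 2"
      using reals_Archimedean[of "e / 2"] e(1) by (auto simp: inverse_eq_divide)
    obtain d where d: "d \<in> D" "dist d x < 1 / real (Suc n)" using D(2)[of "1 / real (Suc n)" x] by auto
    have "ball d (1 / real (Suc n)) \<subseteq> ball x e"
    proof
      fix y assume "y \<in> ball d (1 / real (Suc n))"
      then show "y \<in> ball x e"
        using dist_triangle[of x y d] d(2) n by (simp add: dist_commute)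
    qed
    with d e(2) show "\<exists>B'\<in>?B. x \<in> B' \<and> B' \<subseteq> U"
      by (intro bexI[of _ "ball d (1 / real (Suc n))"]) auto
  qed auto
  moreover have "countable ?B" using D(1) by auto
  ultimately show "\<exists>B :: ell2 set set. countable B \<and> open = generate_topology B"
    by (metis topological_basis_imp_subbasis)
qed

lift_definition lattice_A :: "ell2 \<Rightarrow> ell2"
  is "\<lambda>x i. - x (i - 1) + 2 * x i - x (i + 1)"
proof -
  fix x :: "int \<Rightarrow> real" assume x: "(\<lambda>i. (x i)\<^sup>2) summable_on UNIV"
  have "(\<lambda>i. ((-1) * x (i + (-1)) + 2 * x i + (-1) * x (i + 1))\<^sup>2) summable_on UNIV"
    by (intro square_summable_add square_summable_scale summable_on_shift_int x)
  then show "(\<lambda>i. (- x (i - 1) + 2 * x i - x (i + 1))\<^sup>2) summable_on UNIV" by simp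
qed


section \<open>Fractional Brownian motion on the canonical path space\<close>

text \<open>Gaussian variables are allowed to be degenerate, since \<^term>\<open>\<beta> 0 = 0\<close> for an fBm.\<close>

definition centered_gaussian :: "'w measure \<Rightarrow> ('w \<Rightarrow> real) \<Rightarrow> bool" where
  "centered_gaussian M X \<longleftrightarrow> X \<in> borel_measurable M \<and>
     ((\<exists>s>0. distributed M lborel X (\<lambda>x. ennreal (normal_density 0 s x))) \<or> (AE \<omega> in M. X \<omega> = 0))"

definition centered_gaussian_process :: "'w measure \<Rightarrow> ('t \<Rightarrow> 'w \<Rightarrow> real) \<Rightarrow> bool" where
  "centered_gaussian_process M X \<longleftrightarrow>
     (\<forall>J c. finite J \<longrightarrow> centered_gaussian M (\<lambda>\<omega>. \<Sum>t\<in>J. c t * X t \<omega>))"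

definition fBm :: "real \<Rightarrow> 'w measure \<Rightarrow> (real \<Rightarrow> 'w \<Rightarrow> real) \<Rightarrow> bool" where
  "fBm H M \<beta> \<longleftrightarrow>
     (\<forall>\<omega>\<in>space M. continuous_on UNIV (\<lambda>t. \<beta> t \<omega>)) \<and>
     centered_gaussian_process M \<beta> \<and>
     (\<forall>t s. (LINT \<omega>|M. \<beta> t \<omega> * \<beta> s \<omega>)
        = (\<bar>t\<bar> powr (2 * H) + \<bar>s\<bar> powr (2 * H) - \<bar>t - s\<bar> powr (2 * H)) / 2)"

text \<open>
  Independent fBms \<open>\<omega>\<^sub>i\<close>, \<open>i \<in> \<int>\<close>, with the same Hurst parameter almost surely satisfy
  \<open>\<Sum>\<^sub>i (\<omega>\<^sub>i t)\<^sup>2 = \<infinity>\<close> for every \<open>t \<noteq> 0\<close>, so no probability measure on \<open>C\<^sub>0(\<real>, \<ell>\<^sup>2)\<close> has such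
  coordinates. Paths therefore take values in the space \<^typ>\<open>int \<Rightarrow> real\<close> of all sequences
  (with the product topology); only the noise \<open>\<Sum>\<^sub>i \<sigma>\<^sub>i \<omega>\<^sub>i(t) e\<^sup>i\<close> is required to be a continuous
  \<open>\<ell>\<^sup>2\<close>-valued path, on a set of full measure.
\<close>

type_synonym path = "real \<Rightarrow> int \<Rightarrow> real"

definition C0 :: "path set" where
  "C0 = {\<omega>. continuous_on UNIV \<omega> \<and> \<omega> 0 = (\<lambda>_. 0)}"

definition compact_open_topology :: "path topology" where
  "compact_open_topology =
     topology_generated_by {{\<omega> \<in> C0. \<omega> ` K \<subseteq> U} | K U. compact K \<and> open U}"

definition C0_borel :: "path measure" where
  "C0_borel = sigma C0 {U. openin compact_open_topology U}"

definition canonical_fBm :: "real \<Rightarrow> path measure \<Rightarrow> bool" where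
  "canonical_fBm H P \<longleftrightarrow>
     prob_space P \<and> space P = C0 \<and> sets P = sets C0_borel \<and>
     (\<forall>i. fBm H P (\<lambda>t \<omega>. \<omega> t i)) \<and>
     prob_space.indep_vars P (\<lambda>_. PiM UNIV (\<lambda>_. borel)) (\<lambda>i \<omega> t. \<omega> t i) UNIV"

definition wiener_shift :: "real \<Rightarrow> path \<Rightarrow> path" where
  "wiener_shift t \<omega> = (\<lambda>s i. \<omega> (s + t) i - \<omega> t i)"

definition noise :: "ell2 \<Rightarrow> real \<Rightarrow> path \<Rightarrow> ell2" where
  "noise \<sigma> t \<omega> = (\<Sum>\<^sub>\<infinity>i. (ell2_nth \<sigma> i * \<omega> t i) *\<^sub>R ell2_unit i)"

definition good_noise_set ::
  "ell2 \<Rightarrow> path measure \<Rightarrow> path set \<Rightarrow> (path \<Rightarrow> real) \<Rightarrow> bool" where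
  "good_noise_set \<sigma> P \<Omega> \<rho> \<longleftrightarrow>
     \<Omega> \<in> sets P \<and> measure P \<Omega> = 1 \<and>
     (\<forall>t. \<forall>\<omega>\<in>\<Omega>. wiener_shift t \<omega> \<in> \<Omega>) \<and>
     \<rho> \<in> borel_measurable (restrict_space P \<Omega>) \<and>
     (\<forall>\<omega>\<in>\<Omega>. \<rho> \<omega> > 0 \<and>
        (\<forall>t. (\<lambda>i. (ell2_nth \<sigma> i * \<omega> t i) *\<^sub>R ell2_unit i) summable_on UNIV) \<and>
        continuous_on UNIV (\<lambda>t. noise \<sigma> t \<omega>) \<and>
        (\<forall>t. norm (noise \<sigma> t \<omega>) \<le> \<rho> \<omega> * (1 + \<bar>t\<bar>\<^sup>2)))"


section \<open>Random dynamical systems and random attractors\<close>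

definition metric_dynamical_system :: "'w measure \<Rightarrow> (real \<Rightarrow> 'w \<Rightarrow> 'w) \<Rightarrow> bool" where
  "metric_dynamical_system M \<theta> \<longleftrightarrow>
     prob_space M \<and>
     (\<lambda>(t, \<omega>). \<theta> t \<omega>) \<in> borel \<Otimes>\<^sub>M M \<rightarrow>\<^sub>M M \<and>
     (\<forall>\<omega>\<in>space M. \<theta> 0 \<omega> = \<omega>) \<and>
     (\<forall>t s. \<forall>\<omega>\<in>space M. \<theta> (t + s) \<omega> = \<theta> t (\<theta> s \<omega>)) \<and>
     (\<forall>t. distr M M (\<theta> t) = M)"

definition ergodic_mds :: "'w measure \<Rightarrow> (real \<Rightarrow> 'w \<Rightarrow> 'w) \<Rightarrow> bool" where
  "ergodic_mds M \<theta> \<longleftrightarrow>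
     metric_dynamical_system M \<theta> \<and>
     (\<forall>B\<in>sets M. (\<forall>t. \<theta> t -` B \<inter> space M = B) \<longrightarrow> measure M B = 0 \<or> measure M B = 1)"

definition continuous_rds ::
  "'w measure \<Rightarrow> (real \<Rightarrow> 'w \<Rightarrow> 'w) \<Rightarrow>
     (real \<Rightarrow> 'w \<Rightarrow> 'e::{real_inner, polish_space} \<Rightarrow> 'e) \<Rightarrow> bool" where
  "continuous_rds M \<theta> \<phi> \<longleftrightarrow>
     (\<lambda>(t, \<omega>, x). \<phi> t \<omega> x) \<in> restrict_space borel {0..} \<Otimes>\<^sub>M (M \<Otimes>\<^sub>M borel) \<rightarrow>\<^sub>M borel \<and>
     (\<forall>\<omega>\<in>space M. \<forall>x. \<phi> 0 \<omega> x = x) \<and>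
     (\<forall>t\<ge>0. \<forall>s\<ge>0. \<forall>\<omega>\<in>space M. \<forall>x. \<phi> (t + s) \<omega> x = \<phi> t (\<theta> s \<omega>) (\<phi> s \<omega> x)) \<and>
     (\<forall>t\<ge>0. \<forall>\<omega>\<in>space M. continuous_on UNIV (\<phi> t \<omega>))"

text \<open>
  The convention \<^term>\<open>ln 0 = (0::real)\<close> does not affect the universe below: the bound \<^term>\<open>r\<close>
  can be replaced by \<^term>\<open>\<lambda>\<omega>. max 1 \<bar>r \<omega>\<bar>\<close>.
\<close>

definition tempered_rv :: "'w measure \<Rightarrow> (real \<Rightarrow> 'w \<Rightarrow> 'w) \<Rightarrow> ('w \<Rightarrow> real) \<Rightarrow> bool" where
  "tempered_rv M \<theta> r \<longleftrightarrow> r \<in> borel_measurable M \<and>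
     (AE \<omega> in M. ((\<lambda>t. ln \<bar>r (\<theta> t \<omega>)\<bar> / \<bar>t\<bar>) \<longlongrightarrow> 0) at_top \<and>
                 ((\<lambda>t. ln \<bar>r (\<theta> t \<omega>)\<bar> / \<bar>t\<bar>) \<longlongrightarrow> 0) at_bot)"

definition random_set :: "'w measure \<Rightarrow> ('w \<Rightarrow> 'e::{real_inner, polish_space} set) \<Rightarrow> bool" where
  "random_set M D \<longleftrightarrow>
     (\<forall>\<omega>\<in>space M. D \<omega> \<noteq> {}) \<and> (\<forall>x. (\<lambda>\<omega>. infdist x (D \<omega>)) \<in> borel_measurable M)"

definition tempered_random_sets ::
  "'w measure \<Rightarrow> (real \<Rightarrow> 'w \<Rightarrow> 'w) \<Rightarrow> ('w \<Rightarrow> 'e::{real_inner, polish_space} set) set" where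
  "tempered_random_sets M \<theta> =
     {D. random_set M D \<and> (\<exists>r. tempered_rv M \<theta> r \<and> (\<forall>\<omega>\<in>space M. D \<omega> \<subseteq> {x. norm x \<le> r \<omega>}))}"

text \<open>Extended-real valued, because the first set need not be bounded.\<close>

definition hausdorff_semidist :: "'e::real_normed_vector set \<Rightarrow> 'e set \<Rightarrow> ereal" where
  "hausdorff_semidist X Y = (SUP x\<in>X. INF y\<in>Y. ereal (norm (x - y)))"

text \<open>
  The attraction is required almost surely, since temperedness restricts a random set only
  up to a null set of paths, which may depend on the random set.
\<close>

definition random_attractor ::
  "'w measure \<Rightarrow> (real \<Rightarrow> 'w \<Rightarrow> 'w) \<Rightarrow>
     (real \<Rightarrow> 'w \<Rightarrow> 'e::{real_inner, polish_space} \<Rightarrow> 'e) \<Rightarrow> ('w \<Rightarrow> 'e set) \<Rightarrow> bool" where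
  "random_attractor M \<theta> \<phi> A \<longleftrightarrow>
     random_set M A \<and>
     (\<forall>\<omega>\<in>space M. compact (A \<omega>)) \<and>
     (\<forall>t\<ge>0. \<forall>\<omega>\<in>space M. \<phi> t \<omega> ` A \<omega> = A (\<theta> t \<omega>)) \<and>
     (\<forall>D\<in>tempered_random_sets M \<theta>. AE \<omega> in M.
        ((\<lambda>t. hausdorff_semidist (\<phi> t (\<theta> (-t) \<omega>) ` D (\<theta> (-t) \<omega>)) (A \<omega>)) \<longlongrightarrow> 0) at_top)"


section \<open>The lattice system\<close>

text \<open>
  \<^term>\<open>\<mu>\<close> is the linear damping coefficient, usually written lambda. The integrand is continuous in time
  whenever \<^term>\<open>f\<close> and \<^term>\<open>u\<close> are, so that all the usual integrals agree.
\<close>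

definition pathwise_solution ::
  "real \<Rightarrow> real \<Rightarrow> (ell2 \<Rightarrow> ell2) \<Rightarrow> ell2 \<Rightarrow> ell2 \<Rightarrow> path \<Rightarrow> ell2 \<Rightarrow> (real \<Rightarrow> ell2) \<Rightarrow> bool" where
  "pathwise_solution \<kappa> \<mu> f g \<sigma> \<omega> u0 u \<longleftrightarrow>
     continuous_on {0..} u \<and>
     (\<forall>t\<ge>0. u t = u0
        + integral {0..t} (\<lambda>s. - \<kappa> *\<^sub>R lattice_A (u s) - \<mu> *\<^sub>R u s + f (u s) + g)
        + noise \<sigma> t \<omega>)"

end

theory Submission
  imports Defs
begin

text \<open>
  The drift \<open>-\<kappa>A - \<mu> + f + g\<close> is one-sided Lipschitz with constant \<open>-(\<mu> + L)\<close> because \<open>A\<close> is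
  positive semidefinite, so any two solutions driven by the same path approach each other at the
  rate \<open>c = \<mu> + L\<close>. Subtracting the noise from the solution started at zero turns the equation
  into a random differential equation, and the polynomial growth of the noise and of \<open>f\<close> shows
  that \<open>\<phi> t (\<theta> (-s) \<omega>) 0\<close> grows at most like \<open>exp (c / 2 * (t + s))\<close>. Contraction beats this
  growth: the pullback orbits \<open>\<phi> n (\<theta> (-n) \<omega>) 0\<close> form a Cauchy sequence, and their limit is an
  equilibrium that pullback attracts every tempered set.
\<close>

section \<open>Contracting random dynamical systems\<close>

text \<open>The growth exponent is half the contraction rate: a factor \<open>exp (- c * t)\<close>
  from contraction outweighs \<open>exp (c / 2 * t)\<close> and still leaves decay at rate
  \<open>c / 2\<close>. The constant in \<open>growth\<close> may vary with the path but is uniform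
  in \<open>t\<close> and \<open>s\<close>, so a single one controls the whole backward
  orbit.\<close>

locale contracting_rds =
  fixes M :: "'w measure"
    and \<theta> :: "real \<Rightarrow> 'w \<Rightarrow> 'w"
    and \<phi> :: "real \<Rightarrow> 'w \<Rightarrow> 'e::{real_inner, polish_space, banach} \<Rightarrow> 'e"
    and c :: real
  assumes mds: "metric_dynamical_system M \<theta>"
    and rds: "continuous_rds M \<theta> \<phi>"
    and c_pos: "0 < c"
    and contraction: "\<And>t \<omega> x y. 0 \<le> t \<Longrightarrow> \<omega> \<in> space M \<Longrightarrow>
      norm (\<phi> t \<omega> x - \<phi> t \<omega> y) \<le> exp (- c * t) * norm (x - y)"
    and growth: "\<And>\<omega>. \<omega> \<in> space M \<Longrightarrow>
      \<exists>C. \<forall>t\<ge>0. \<forall>s\<ge>0. norm (\<phi> t (\<theta> (- s) \<omega>) 0) \<le> C * exp (c / 2 * (t + s))"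
begin

section \<open>Measurability, group law and cocycle identities\<close>

lemma theta_measurable: "\<theta> t \<in> M \<rightarrow>\<^sub>M M"
proof -
  have "(\<lambda>(t, \<omega>). \<theta> t \<omega>) \<circ> (\<lambda>\<omega>. (t, \<omega>)) \<in> M \<rightarrow>\<^sub>M M"
    using mds by (intro measurable_comp[where N = "borel \<Otimes>\<^sub>M M"]) (auto simp: metric_dynamical_system_def)
  then show ?thesis by (simp add: o_def)
qed

lemma theta_space: "\<omega> \<in> space M \<Longrightarrow> \<theta> t \<omega> \<in> space M"
  using theta_measurable by (rule measurable_space)

lemma theta_0: "\<omega> \<in> space M \<Longrightarrow> \<theta> 0 \<omega> = \<omega>"
  using mds by (simp add: metric_dynamical_system_def)

lemma theta_add: "\<omega> \<in> space M \<Longrightarrow> \<theta> t (\<theta> s \<omega>) = \<theta> (t + s) \<omega>"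
  using mds by (simp add: metric_dynamical_system_def)

lemma measure_theta_vimage:
  assumes "A \<in> sets M" shows "measure M (\<theta> t -` A \<inter> space M) = measure M A"
proof -
  have "measure (distr M M (\<theta> t)) A = measure M (\<theta> t -` A \<inter> space M)"
    using theta_measurable assms by (rule measure_distr)
  then show ?thesis using mds by (simp add: metric_dynamical_system_def)
qed

lemma cocycle:
  "0 \<le> t \<Longrightarrow> 0 \<le> s \<Longrightarrow> \<omega> \<in> space M \<Longrightarrow> \<phi> (t + s) \<omega> x = \<phi> t (\<theta> s \<omega>) (\<phi> s \<omega> x)"
  using rds by (simp add: continuous_rds_def)

section \<open>The pullback limit and its growth along backward orbits\<close>

definition pullback :: "nat \<Rightarrow> 'w \<Rightarrow> 'e" where
  "pullback n \<omega> = \<phi> (real n) (\<theta> (- real n) \<omega>) 0"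

text \<open>Sampling at integer times makes this the limit of a sequence of measurable maps. The
  value of \<open>lim\<close> carries information only where the sequence converges, which
  \<open>pullback_tendsto\<close> establishes on \<open>space M\<close>.\<close>

definition equilibrium :: "'w \<Rightarrow> 'e" where
  "equilibrium \<omega> = lim (\<lambda>n. pullback n \<omega>)"

lemma pullback_measurable: "pullback n \<in> borel_measurable M"
proof -
  have "(\<lambda>(t, \<omega>, x). \<phi> t \<omega> x) \<circ> (\<lambda>\<omega>. (real n, \<theta> (- real n) \<omega>, 0)) \<in> M \<rightarrow>\<^sub>M borel"
  proof (rule measurable_comp)
    show "(\<lambda>(t, \<omega>, x). \<phi> t \<omega> x) \<in> restrict_space borel {0..} \<Otimes>\<^sub>M (M \<Otimes>\<^sub>M borel) \<rightarrow>\<^sub>M borel"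
      using rds by (simp add: continuous_rds_def)
    show "(\<lambda>\<omega>. (real n, \<theta> (- real n) \<omega>, 0)) \<in> M \<rightarrow>\<^sub>M restrict_space borel {0..} \<Otimes>\<^sub>M (M \<Otimes>\<^sub>M borel)"
      by (intro measurable_Pair theta_measurable measurable_const) (auto simp: space_restrict_space)
  qed
  then show ?thesis by (simp add: o_def pullback_def[abs_def])
qed

text \<open>By the cocycle property both iterates are images under the same map of duration
  \<open>n\<close> over \<open>\<theta> (- real n) \<omega>\<close>: one starts at 0, the other at
  the point reached from 0 in one earlier unit of time. Contraction over time \<open>n\<close>
  compares them.\<close>

lemma pullback_step:
  assumes "\<omega> \<in> space M"
  shows "norm (pullback (Suc n) \<omega> - pullback n \<omega>)
    \<le> exp (- c * real n) * norm (\<phi> 1 (\<theta> (- (1 + real n)) \<omega>) 0)"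
proof -
  have "pullback (Suc n) \<omega> = \<phi> (real n + 1) (\<theta> (- (1 + real n)) \<omega>) 0"
    by (simp add: pullback_def add.commute)
  also have "\<dots> = \<phi> (real n) (\<theta> 1 (\<theta> (- (1 + real n)) \<omega>)) (\<phi> 1 (\<theta> (- (1 + real n)) \<omega>) 0)"
    by (rule cocycle) (use assms theta_space in auto)
  also have "\<theta> 1 (\<theta> (- (1 + real n)) \<omega>) = \<theta> (- real n) \<omega>"
    using theta_add[OF assms, of 1 "- (1 + real n)"] by simp
  finally show ?thesis
    using contraction[of "real n" "\<theta> (- real n) \<omega>" "\<phi> 1 (\<theta> (- (1 + real n)) \<omega>) 0" 0] theta_space[OF assms]
    by (simp add: pullback_def)
qed

text \<open>The increments of the pullback sequence are dominated by a geometric series, so their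
  telescoping sum converges. One constant serves every \<open>s\<close>; the resulting bound along
  the backward orbit takes the place of temperedness of the equilibrium in the attraction and
  uniqueness arguments.\<close>

lemma equilibrium_limit_bound:
  assumes \<omega>: "\<omega> \<in> space M"
  obtains C where "0 \<le> C"
    "\<And>s. 0 \<le> s \<Longrightarrow> (\<lambda>n. pullback n (\<theta> (- s) \<omega>)) \<longlonglongrightarrow> equilibrium (\<theta> (- s) \<omega>)"
    "\<And>s. 0 \<le> s \<Longrightarrow> norm (equilibrium (\<theta> (- s) \<omega>)) \<le> C * exp (c / 2 * s)"
proof -
  obtain C where C: "\<And>t s. 0 \<le> t \<Longrightarrow> 0 \<le> s \<Longrightarrow> norm (\<phi> t (\<theta> (- s) \<omega>) 0) \<le> C * exp (c / 2 * (t + s))"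
    using growth[OF \<omega>] by blast
  have "0 \<le> C * exp (c / 2 * (0 + 0))"
    using norm_ge_zero C[of 0 0] by (rule order_trans) auto
  then have C0: "0 \<le> C" by simp
  \<comment> \<open>The ratio is what remains per unit of time when contraction by
    \<open>exp (- c)\<close> meets growth by \<open>exp (c / 2)\<close>.\<close>
  define q where "q = exp (- c / 2)"
  have q: "0 < q" "q < 1" using c_pos by (auto simp: q_def)
  have step: "norm (pullback (Suc n) (\<theta> (- s) \<omega>) - pullback n (\<theta> (- s) \<omega>))
      \<le> C * exp c * exp (c / 2 * s) * q ^ n" if "0 \<le> s" for s n
  proof -
    have "norm (pullback (Suc n) (\<theta> (- s) \<omega>) - pullback n (\<theta> (- s) \<omega>))
        \<le> exp (- c * real n) * norm (\<phi> 1 (\<theta> (- (1 + real n)) (\<theta> (- s) \<omega>)) 0)"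
      by (intro pullback_step theta_space \<omega>)
    also have "\<theta> (- (1 + real n)) (\<theta> (- s) \<omega>) = \<theta> (- (1 + real n + s)) \<omega>"
      using theta_add[OF \<omega>, of "- (1 + real n)" "- s"] by (simp add: algebra_simps)
    \<comment> \<open>The point is reached in time 1 over the path shifted back by
      \<open>1 + n + s\<close>, so growth contributes \<open>c / 2 * (2 + n + s)\<close>; the
      summand 2 becomes the factor \<open>exp c\<close>.\<close>
    also have "exp (- c * real n) * norm (\<phi> 1 \<dots> 0)
        \<le> exp (- c * real n) * (C * exp (c / 2 * (1 + (1 + real n + s))))"
      using that by (intro mult_left_mono C) auto
    also have "\<dots> = C * (exp (- c * real n) * exp (c / 2 * (1 + (1 + real n + s))))"
      by simp
    also have "exp (- c * real n) * exp (c / 2 * (1 + (1 + real n + s)))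
        = exp (c + c / 2 * s + real n * (- c / 2))"
      unfolding exp_add[symmetric] by (simp add: field_simps)
    also have "\<dots> = exp c * exp (c / 2 * s) * q ^ n"
      unfolding exp_add q_def exp_of_nat_mult ..
    finally show ?thesis by (simp add: mult_ac)
  qed
  define x where "x s n = pullback (Suc n) (\<theta> (- s) \<omega>) - pullback n (\<theta> (- s) \<omega>)" for s n
  have gsum: "(\<lambda>n. C * exp c * exp (c / 2 * s) * q ^ n) sums (C * exp c * exp (c / 2 * s) * (1 / (1 - q)))" for s
    by (intro sums_mult geometric_sums) (use q in auto)
  have xsum: "summable (\<lambda>n. norm (x s n))" if "0 \<le> s" for s
    by (rule summable_comparison_test'[OF sums_summable[OF gsum[of s]], of 0])
      (use step[OF that] in \<open>simp add: x_def\<close>)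
  have lim: "(\<lambda>n. pullback n (\<theta> (- s) \<omega>)) \<longlonglongrightarrow> pullback 0 (\<theta> (- s) \<omega>) + suminf (x s)"
    if "0 \<le> s" for s
  proof -
    have "(\<lambda>n. pullback 0 (\<theta> (- s) \<omega>) + (\<Sum>i<n. x s i)) \<longlonglongrightarrow> pullback 0 (\<theta> (- s) \<omega>) + suminf (x s)"
      using summable_LIMSEQ[OF summable_norm_cancel[OF xsum[OF that]]] by (intro tendsto_add tendsto_const)
    moreover have "(\<Sum>i<n. x s i) = pullback n (\<theta> (- s) \<omega>) - pullback 0 (\<theta> (- s) \<omega>)" for n
      unfolding x_def by (rule sum_lessThan_telescope)
    ultimately show ?thesis by simp
  qed
  have p0: "pullback 0 (\<theta> (- s) \<omega>) = 0" for s
    using rds theta_space[OF \<omega>] by (simp add: pullback_def theta_0 continuous_rds_def)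
  have lim': "(\<lambda>n. pullback n (\<theta> (- s) \<omega>)) \<longlonglongrightarrow> equilibrium (\<theta> (- s) \<omega>)"
    and eq: "equilibrium (\<theta> (- s) \<omega>) = suminf (x s)" if "0 \<le> s" for s
    using lim[OF that] limI[OF lim[OF that]] p0 by (simp_all add: equilibrium_def)
  show thesis
  proof (rule that)
    show "0 \<le> C * exp c * (1 / (1 - q))" using C0 q by simp
    fix s :: real assume s: "0 \<le> s"
    show "(\<lambda>n. pullback n (\<theta> (- s) \<omega>)) \<longlonglongrightarrow> equilibrium (\<theta> (- s) \<omega>)" by (rule lim'[OF s])
    have "norm (equilibrium (\<theta> (- s) \<omega>)) \<le> (\<Sum>n. norm (x s n))"
      unfolding eq[OF s] by (rule summable_norm[OF xsum[OF s]])
    also have "\<dots> \<le> (\<Sum>n. C * exp c * exp (c / 2 * s) * q ^ n)"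
      by (intro suminf_le xsum s sums_summable[OF gsum]) (use step[OF s] in \<open>simp add: x_def\<close>)
    also have "\<dots> = C * exp c * (1 / (1 - q)) * exp (c / 2 * s)"
      using sums_unique[OF gsum[of s]] by simp
    finally show "norm (equilibrium (\<theta> (- s) \<omega>)) \<le> C * exp c * (1 / (1 - q)) * exp (c / 2 * s)" .
  qed
qed

lemma pullback_tendsto: "\<omega> \<in> space M \<Longrightarrow> (\<lambda>n. pullback n \<omega>) \<longlonglongrightarrow> equilibrium \<omega>"
  by (metis equilibrium_limit_bound minus_zero order_refl theta_0)

lemma equilibrium_measurable: "equilibrium \<in> borel_measurable M"
  by (rule borel_measurable_LIMSEQ_metric[OF pullback_measurable pullback_tendsto])

section \<open>Invariance and pullback attraction of the equilibrium\<close>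

lemma exp_neg_tendsto_0: "((\<lambda>t. exp (- (c / 2) * t)) \<longlongrightarrow> 0) at_top"
  using c_pos by (intro filterlim_compose[OF exp_at_bot]
    filterlim_tendsto_neg_mult_at_bot[OF tendsto_const _ filterlim_ident]) auto

text \<open>A run of length \<open>t + n\<close> from 0 over
  \<open>\<theta> (- real n) \<omega>\<close> splits in two ways. Taking \<open>n\<close> first
  gives \<open>\<phi> t \<omega> (pullback n \<omega>)\<close>; taking \<open>t\<close> first leaves
  \<open>n\<close> units of contraction towards \<open>pullback n (\<theta> t \<omega>)\<close>. The
  gap is of order \<open>exp (- (c / 2) * n)\<close>, and continuity of
  \<open>\<phi> t \<omega>\<close> carries the identity to the limit.\<close>

lemma equilibrium_invariant:
  assumes t: "0 \<le> t" and \<omega>: "\<omega> \<in> space M"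
  shows "\<phi> t \<omega> (equilibrium \<omega>) = equilibrium (\<theta> t \<omega>)"
proof -
  obtain C where C: "\<And>t s. 0 \<le> t \<Longrightarrow> 0 \<le> s \<Longrightarrow> norm (\<phi> t (\<theta> (- s) \<omega>) 0) \<le> C * exp (c / 2 * (t + s))"
    using growth[OF \<omega>] by blast
  have diff: "norm (\<phi> t \<omega> (pullback n \<omega>) - pullback n (\<theta> t \<omega>))
      \<le> C * exp (c / 2 * t) * exp (- (c / 2) * real n)" for n
  proof -
    have sp: "\<theta> (- real n) \<omega> \<in> space M" by (rule theta_space[OF \<omega>])
    have e1: "\<theta> (real n) (\<theta> (- real n) \<omega>) = \<omega>"
      using theta_add[OF \<omega>] theta_0[OF \<omega>] by simp
    have e2: "\<theta> (- real n) (\<theta> t \<omega>) = \<theta> t (\<theta> (- real n) \<omega>)"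
      using theta_add[OF \<omega>] by (simp add: add.commute)
    have "\<phi> t \<omega> (pullback n \<omega>) = \<phi> (t + real n) (\<theta> (- real n) \<omega>) 0"
      using cocycle[OF t _ sp, of "real n" 0] by (simp add: pullback_def e1)
    also have "\<dots> = \<phi> (real n) (\<theta> t (\<theta> (- real n) \<omega>)) (\<phi> t (\<theta> (- real n) \<omega>) 0)"
      using cocycle[OF _ t sp, of "real n" 0] by (simp add: add.commute)
    finally have "norm (\<phi> t \<omega> (pullback n \<omega>) - pullback n (\<theta> t \<omega>))
        \<le> exp (- c * real n) * norm (\<phi> t (\<theta> (- real n) \<omega>) 0)"
      using contraction[of "real n" "\<theta> t (\<theta> (- real n) \<omega>)" "\<phi> t (\<theta> (- real n) \<omega>) 0" 0]
      by (simp add: pullback_def e2 theta_space[OF sp])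
    also have "\<dots> \<le> exp (- c * real n) * (C * exp (c / 2 * (t + real n)))"
      by (intro mult_left_mono C t) auto
    also have "\<dots> = C * (exp (- c * real n) * exp (c / 2 * (t + real n)))" by simp
    also have "\<dots> = C * exp (c / 2 * t) * exp (- (c / 2) * real n)"
      unfolding mult.assoc exp_add[symmetric] by (simp add: field_simps)
    finally show ?thesis .
  qed
  have "(\<lambda>n. \<phi> t \<omega> (pullback n \<omega>)) \<longlonglongrightarrow> \<phi> t \<omega> (equilibrium \<omega>)"
    using rds t \<omega>
    by (intro continuous_on_tendsto_compose[OF _ pullback_tendsto[OF \<omega>], of UNIV])
      (auto simp: continuous_rds_def)
  then have "(\<lambda>n. \<phi> t \<omega> (pullback n \<omega>) - pullback n (\<theta> t \<omega>))
      \<longlonglongrightarrow> \<phi> t \<omega> (equilibrium \<omega>) - equilibrium (\<theta> t \<omega>)"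
    by (intro tendsto_diff pullback_tendsto theta_space \<omega>)
  moreover have "(\<lambda>n. \<phi> t \<omega> (pullback n \<omega>) - pullback n (\<theta> t \<omega>)) \<longlonglongrightarrow> 0"
  proof (rule Lim_null_comparison)
    show "\<forall>\<^sub>F n in sequentially. norm (\<phi> t \<omega> (pullback n \<omega>) - pullback n (\<theta> t \<omega>))
        \<le> C * exp (c / 2 * t) * exp (- (c / 2) * real n)"
      using diff by simp
    show "(\<lambda>n. C * exp (c / 2 * t) * exp (- (c / 2) * real n)) \<longlonglongrightarrow> 0"
      by (rule tendsto_mult_right_zero[OF filterlim_compose[OF exp_neg_tendsto_0 filterlim_real_sequentially]])
  qed
  ultimately show ?thesis using LIMSEQ_unique by fastforce
qed

text \<open>By invariance the equilibrium at \<open>\<omega>\<close> is itself an image under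
  \<open>\<phi> t (\<theta> (- t) \<omega>)\<close>, so contraction applies to the two starting
  points.\<close>

lemma pullback_distance:
  assumes t: "0 \<le> t" and \<omega>: "\<omega> \<in> space M"
  shows "norm (\<phi> t (\<theta> (- t) \<omega>) x - equilibrium \<omega>)
    \<le> exp (- c * t) * (norm x + norm (equilibrium (\<theta> (- t) \<omega>)))"
proof -
  have "equilibrium \<omega> = \<phi> t (\<theta> (- t) \<omega>) (equilibrium (\<theta> (- t) \<omega>))"
    using equilibrium_invariant[OF t theta_space[OF \<omega>]] theta_add[OF \<omega>] theta_0[OF \<omega>] by simp
  then have "norm (\<phi> t (\<theta> (- t) \<omega>) x - equilibrium \<omega>)
      \<le> exp (- c * t) * norm (x - equilibrium (\<theta> (- t) \<omega>))"
    using contraction[OF t theta_space[OF \<omega>]] by metis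
  also have "\<dots> \<le> exp (- c * t) * (norm x + norm (equilibrium (\<theta> (- t) \<omega>)))"
    by (intro mult_left_mono norm_triangle_ineq4) auto
  finally show ?thesis .
qed

lemma equilibrium_attracts:
  assumes D: "D \<in> tempered_random_sets M \<theta>"
  shows "AE \<omega> in M.
    ((\<lambda>t. hausdorff_semidist (\<phi> t (\<theta> (- t) \<omega>) ` D (\<theta> (- t) \<omega>)) {equilibrium \<omega>}) \<longlongrightarrow> 0) at_top"
proof -
  obtain r where r: "tempered_rv M \<theta> r" "\<And>\<omega>. \<omega> \<in> space M \<Longrightarrow> D \<omega> \<subseteq> {x. norm x \<le> r \<omega>}"
    and ne: "\<And>\<omega>. \<omega> \<in> space M \<Longrightarrow> D \<omega> \<noteq> {}"
    using D by (auto simp: tempered_random_sets_def random_set_def)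
  have "AE \<omega> in M. ((\<lambda>t. ln \<bar>r (\<theta> t \<omega>)\<bar> / \<bar>t\<bar>) \<longlongrightarrow> 0) at_bot"
    using r(1) unfolding tempered_rv_def by auto
  with AE_space show ?thesis
  proof eventually_elim
    case (elim \<omega>)
    note \<omega> = elim(1)
    obtain C where C: "\<And>s. 0 \<le> s \<Longrightarrow> norm (equilibrium (\<theta> (- s) \<omega>)) \<le> C * exp (c / 2 * s)"
      using equilibrium_limit_bound[OF \<omega>] by metis
    have "((\<lambda>t. ln \<bar>r (\<theta> (- t) \<omega>)\<bar> / \<bar>- t\<bar>) \<longlongrightarrow> 0) at_top"
      by (rule filterlim_compose[OF elim(2) filterlim_uminus_at_bot_at_top])
    \<comment> \<open>The threshold \<open>c / 2\<close> turns temperedness into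
      \<open>r (\<theta> (- t) \<omega>) \<le> exp (c / 2 * t)\<close> for large \<open>t\<close>,
      half of what contraction can absorb.\<close>
    then have "\<forall>\<^sub>F t in at_top. ln \<bar>r (\<theta> (- t) \<omega>)\<bar> / \<bar>- t\<bar> < c / 2"
      by (rule order_tendstoD) (use c_pos in simp)
    then have bound: "\<forall>\<^sub>F t in at_top.
        hausdorff_semidist (\<phi> t (\<theta> (- t) \<omega>) ` D (\<theta> (- t) \<omega>)) {equilibrium \<omega>}
          \<le> ereal ((1 + C) * exp (- (c / 2) * t))"
      using eventually_gt_at_top[of 0]
    proof eventually_elim
      case (elim t)
      define \<rho> where "\<rho> = r (\<theta> (- t) \<omega>)"
      have "ln \<bar>\<rho>\<bar> \<le> c / 2 * t" using elim by (simp add: \<rho>_def field_simps)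
      \<comment> \<open>If \<open>\<rho> = 0\<close> the logarithm is the default value 0, but the
        bound is then trivial; otherwise exponentiate.\<close>
      then have "\<bar>\<rho>\<bar> \<le> exp (c / 2 * t)"
        by (cases "\<rho> = 0") (auto simp: ln_ge_iff[symmetric] ln_le_cancel_iff[symmetric] simp del: ln_le_cancel_iff)
      then have \<rho>: "\<rho> \<le> exp (c / 2 * t)" by simp
      have "norm (\<phi> t (\<theta> (- t) \<omega>) x - equilibrium \<omega>) \<le> (1 + C) * exp (- (c / 2) * t)"
        if "x \<in> D (\<theta> (- t) \<omega>)" for x
      proof -
        have "norm x \<le> exp (c / 2 * t)"
          using r(2)[OF theta_space[OF \<omega>], of "- t"] that \<rho> by (auto simp: \<rho>_def)
        moreover have "norm (equilibrium (\<theta> (- t) \<omega>)) \<le> C * exp (c / 2 * t)"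
          using C elim by simp
        ultimately have "norm (\<phi> t (\<theta> (- t) \<omega>) x - equilibrium \<omega>)
            \<le> exp (- c * t) * (exp (c / 2 * t) + C * exp (c / 2 * t))"
          using pullback_distance[of t \<omega> x] elim \<omega>
          by (smt (verit) exp_ge_zero mult_left_mono)
        also have "\<dots> = (1 + C) * (exp (- c * t) * exp (c / 2 * t))"
          by (simp add: algebra_simps)
        also have "exp (- c * t) * exp (c / 2 * t) = exp (- (c / 2) * t)"
          unfolding exp_add[symmetric] by (simp add: field_simps)
        finally show ?thesis .
      qed
      then show ?case
        by (auto simp: hausdorff_semidist_def intro!: SUP_least)
    qed
    \<comment> \<open>Nonemptiness of the sections enters here: the supremum over an empty set would
      be minus infinity.\<close>
    have nonneg: "0 \<le> hausdorff_semidist (\<phi> t (\<theta> (- t) \<omega>) ` D (\<theta> (- t) \<omega>)) {equilibrium \<omega>}" for t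
    proof -
      obtain x where "x \<in> D (\<theta> (- t) \<omega>)" using ne theta_space[OF \<omega>] by blast
      then show ?thesis
        unfolding hausdorff_semidist_def by (intro SUP_upper2[of "\<phi> t (\<theta> (- t) \<omega>) x"]) auto
    qed
    show ?case
    proof (rule tendsto_sandwich[OF _ bound tendsto_const])
      have "((\<lambda>t. (1 + C) * exp (- (c / 2) * t)) \<longlongrightarrow> 0) at_top"
        by (intro tendsto_mult_right_zero exp_neg_tendsto_0)
      then show "((\<lambda>t. ereal ((1 + C) * exp (- (c / 2) * t))) \<longlongrightarrow> 0) at_top"
        by (simp add: zero_ereal_def)
    qed (use nonneg in simp)
  qed
qed

theorem equilibrium_random_attractor: "random_attractor M \<theta> \<phi> (\<lambda>\<omega>. {equilibrium \<omega>})"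
  unfolding random_attractor_def random_set_def
  using equilibrium_invariant equilibrium_attracts equilibrium_measurable
  by auto

section \<open>Uniqueness of the attractor up to a null set\<close>

lemma random_set_escape_measurable:
  fixes B :: "'w \<Rightarrow> 'e set"
  assumes "random_set M B"
  shows "{\<omega> \<in> space M. \<not> B \<omega> \<subseteq> cball 0 m} \<in> sets M"
proof -
  obtain D :: "'e set" where D: "countable D" "\<And>X. open X \<Longrightarrow> X \<noteq> {} \<Longrightarrow> \<exists>d\<in>D. d \<in> X"
    by (rule countable_dense_setE) blast
  \<comment> \<open>A set lies in the ball of radius \<open>m\<close> exactly when every
    \<open>d\<close> has distance at least \<open>norm d - m\<close> from it. By density countably
    many \<open>d\<close> detect a violation, and their distance functions are measurable.\<close>
  have "{\<omega> \<in> space M. \<not> B \<omega> \<subseteq> cball 0 m} = (\<Union>d\<in>D. {\<omega> \<in> space M. infdist d (B \<omega>) < norm d - m})"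
  proof -
    have "\<not> B \<omega> \<subseteq> cball 0 m \<longleftrightarrow> (\<exists>d\<in>D. infdist d (B \<omega>) < norm d - m)" if \<omega>: "\<omega> \<in> space M" for \<omega>
    proof
      assume "\<not> B \<omega> \<subseteq> cball 0 m"
      then obtain b where b: "b \<in> B \<omega>" "b \<notin> cball 0 m" by blast
      \<comment> \<open>Half the excess \<open>norm b - m\<close> leaves room for two errors of size
        \<open>dist b d\<close>: one in the distance of \<open>d\<close> to the section, one in
        \<open>norm d\<close>.\<close>
      then obtain d where d: "d \<in> D" "dist b d < (norm b - m) / 2"
        using D(2)[of "ball b ((norm b - m) / 2)"] b(2) by auto
      have "infdist d (B \<omega>) \<le> dist d b" using b(1) by (rule infdist_le)
      moreover have "norm b \<le> norm d + dist b d" by (simp add: dist_norm norm_triangle_sub)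
      ultimately have "infdist d (B \<omega>) < norm d - m" using d(2) by (simp add: dist_commute)
      with d(1) show "\<exists>d\<in>D. infdist d (B \<omega>) < norm d - m" by blast
    next
      assume "\<exists>d\<in>D. infdist d (B \<omega>) < norm d - m"
      then obtain d where lt: "infdist d (B \<omega>) < norm d - m" by blast
      have ne: "B \<omega> \<noteq> {}" using assms \<omega> by (simp add: random_set_def)
      show "\<not> B \<omega> \<subseteq> cball 0 m"
      proof
        assume sub: "B \<omega> \<subseteq> cball 0 m"
        have "norm d - m \<le> dist d b" if "b \<in> B \<omega>" for b
          using that sub norm_triangle_sub[of d b] by (force simp: dist_norm)
        then have "norm d - m \<le> infdist d (B \<omega>)"
          unfolding infdist_notempty[OF ne] using ne by (intro cINF_greatest)
        with lt show False by simp
      qed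
    qed
    then show ?thesis by auto
  qed
  also have "\<dots> \<in> sets M"
    using assms D(1) by (intro sets.countable_UN'') (auto simp: random_set_def intro!: borel_measurable_less)
  finally show ?thesis .
qed

text \<open>
  The sections of an attractor are not assumed to be tempered. Since \<open>\<theta>\<close> preserves the measure,
  they almost surely return to some fixed ball along a sequence of times \<open>-n\<close>, which suffices.
\<close>

theorem random_attractor_unique:
  fixes B :: "'w \<Rightarrow> 'e set"
  assumes B: "random_attractor M \<theta> \<phi> B"
  shows "AE \<omega> in M. B \<omega> = {equilibrium \<omega>}"
proof -
  interpret prob_space M using mds by (simp add: metric_dynamical_system_def)
  have rs: "random_set M B" and cpt: "\<And>\<omega>. \<omega> \<in> space M \<Longrightarrow> compact (B \<omega>)"
    and inv: "\<And>t \<omega>. 0 \<le> t \<Longrightarrow> \<omega> \<in> space M \<Longrightarrow> \<phi> t \<omega> ` B \<omega> = B (\<theta> t \<omega>)"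
    using B by (auto simp: random_attractor_def)
  \<comment> \<open>\<open>E m\<close> holds the paths whose section leaves the ball of radius
    \<open>m\<close>, and \<open>F m N\<close> those for which this happens at all times
    \<open>-n\<close> with \<open>n \<ge> N\<close>. Outside \<open>Z\<close> some fixed ball
    contains the sections at arbitrarily large \<open>n\<close>.\<close>
  define E where "E m = {\<omega> \<in> space M. \<not> B \<omega> \<subseteq> cball 0 (real m)}" for m
  define F where "F m N = (\<Inter>n\<in>{N..}. \<theta> (- real n) -` E m \<inter> space M)" for m N
  define Z where "Z = (\<Inter>m. \<Union>N. F m N)"
  have E_sets: "E m \<in> sets M" for m
    unfolding E_def by (rule random_set_escape_measurable[OF rs])
  have F_sets: "F m N \<in> sets M" for m N
    unfolding F_def by (intro sets.countable_INT') (use measurable_sets[OF theta_measurable E_sets] in auto)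
  have Z_sets: "Z \<in> sets M"
    unfolding Z_def using F_sets by (intro sets.countable_INT sets.countable_UN) (auto intro!: sets.countable_UN)
  have "(\<Inter>m. E m) = {}"
  proof -
    have "\<exists>m. B \<omega> \<subseteq> cball 0 (real m)" if \<omega>: "\<omega> \<in> space M" for \<omega>
    proof -
      obtain b where "\<forall>x\<in>B \<omega>. norm x \<le> b"
        using compact_imp_bounded[OF cpt[OF \<omega>]] by (auto simp: bounded_iff)
      moreover obtain m where "b \<le> real m" using real_arch_simple by blast
      ultimately show ?thesis by (intro exI[of _ m]) force
    qed
    then show ?thesis by (auto simp: E_def)
  qed
  moreover have "(\<lambda>m. measure M (E m)) \<longlonglongrightarrow> measure M (\<Inter>m. E m)"
  proof (rule finite_Lim_measure_decseq)
    have "cball 0 (real m) \<subseteq> (cball 0 (real n) :: 'e set)" if "m \<le> n" for m n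
      using that by (intro subset_cball) simp
    then show "decseq E" by (fastforce simp: decseq_def E_def)
  qed (use E_sets in auto)
  ultimately have E_lim: "(\<lambda>m. measure M (E m)) \<longlonglongrightarrow> 0" by simp
  \<comment> \<open>For fixed \<open>m\<close> the sets \<open>F m N\<close> increase with
    \<open>N\<close>, and each lies in a shifted copy of \<open>E m\<close>, which has the same
    measure by invariance.\<close>
  have "measure M Z \<le> measure M (E m)" for m
  proof -
    have "measure M Z \<le> measure M (\<Union>N. F m N)"
      using F_sets by (intro finite_measure_mono) (auto simp: Z_def)
    also have "\<dots> \<le> measure M (E m)"
    proof (rule LIMSEQ_le_const2)
      show "(\<lambda>N. measure M (F m N)) \<longlonglongrightarrow> measure M (\<Union>N. F m N)"
        by (rule finite_Lim_measure_incseq) (use F_sets in \<open>auto simp: incseq_def F_def\<close>)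
      have "measure M (F m N) \<le> measure M (\<theta> (- real N) -` E m \<inter> space M)" for N
        by (intro finite_measure_mono measurable_sets[OF theta_measurable] E_sets) (auto simp: F_def)
      then show "\<exists>N0. \<forall>N\<ge>N0. measure M (F m N) \<le> measure M (E m)"
        by (simp add: measure_theta_vimage[OF E_sets])
    qed
    finally show ?thesis .
  qed
  then have "measure M Z \<le> 0"
    by (intro LIMSEQ_le_const[OF E_lim]) auto
  then have "Z \<in> null_sets M"
    using Z_sets by (simp add: null_sets_def emeasure_eq_measure measure_le_0_iff)
  moreover have "B \<omega> = {equilibrium \<omega>}" if \<omega>: "\<omega> \<in> space M" and "\<omega> \<notin> Z" for \<omega>
  proof -
    obtain m where "\<forall>N. \<exists>n\<in>{N..}. B (\<theta> (- real n) \<omega>) \<subseteq> cball 0 (real m)"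
      using \<open>\<omega> \<notin> Z\<close> \<omega> theta_space[OF \<omega>] by (auto simp: Z_def F_def E_def)
    then have m: "\<exists>n\<ge>N. B (\<theta> (- real n) \<omega>) \<subseteq> cball 0 (real m)" for N by force
    obtain C where C: "0 \<le> C" "\<And>s. 0 \<le> s \<Longrightarrow> norm (equilibrium (\<theta> (- s) \<omega>)) \<le> C * exp (c / 2 * s)"
      using equilibrium_limit_bound[OF \<omega>] by metis
    have "x = equilibrium \<omega>" if x: "x \<in> B \<omega>" for x
    proof (rule ccontr)
      assume "x \<noteq> equilibrium \<omega>"
      then have pos: "0 < norm (x - equilibrium \<omega>)" by simp
      have "(\<lambda>n. (real m + C) * exp (- (c / 2) * real n)) \<longlonglongrightarrow> 0"
        by (rule tendsto_mult_right_zero[OF filterlim_compose[OF exp_neg_tendsto_0 filterlim_real_sequentially]])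
      from order_tendstoD(2)[OF this pos] obtain N where
        N: "\<And>n. N \<le> n \<Longrightarrow> (real m + C) * exp (- (c / 2) * real n) < norm (x - equilibrium \<omega>)"
        by (auto simp: eventually_sequentially)
      obtain n where n: "N \<le> n" "B (\<theta> (- real n) \<omega>) \<subseteq> cball 0 (real m)" using m by blast
      \<comment> \<open>Invariance gives \<open>x\<close> a preimage in the section that has
        returned to the ball, and \<open>n\<close> was chosen so that contraction brings its image
        closer to the equilibrium than \<open>x\<close> is.\<close>
      have "B \<omega> = \<phi> (real n) (\<theta> (- real n) \<omega>) ` B (\<theta> (- real n) \<omega>)"
        using inv[OF _ theta_space[OF \<omega>], of "real n"] theta_add[OF \<omega>] theta_0[OF \<omega>] by simp
      then obtain y where y: "y \<in> B (\<theta> (- real n) \<omega>)" "x = \<phi> (real n) (\<theta> (- real n) \<omega>) y"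
        using x by auto
      have "norm y \<le> real m" using y(1) n(2) by auto
      also have "\<dots> \<le> real m * exp (c / 2 * real n)"
        using c_pos by (simp add: mult_le_cancel_left1)
      finally have "norm y + norm (equilibrium (\<theta> (- real n) \<omega>)) \<le> (real m + C) * exp (c / 2 * real n)"
        using C(2)[of "real n"] by (simp add: distrib_right)
      then have "norm (x - equilibrium \<omega>) \<le> exp (- c * real n) * ((real m + C) * exp (c / 2 * real n))"
        using pullback_distance[of "real n" \<omega> y] \<omega> unfolding y(2)[symmetric]
        by (smt (verit) exp_ge_zero mult_left_mono of_nat_0_le_iff)
      also have "\<dots> = (real m + C) * (exp (- c * real n) * exp (c / 2 * real n))" by simp
      also have "exp (- c * real n) * exp (c / 2 * real n) = exp (- (c / 2) * real n)"
        unfolding exp_add[symmetric] by (simp add: field_simps)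
      finally show False using N[OF n(1)] by simp
    qed
    moreover have "B \<omega> \<noteq> {}" using rs \<omega> by (simp add: random_set_def)
    ultimately show ?thesis by blast
  qed
  ultimately show ?thesis by (intro AE_I'[of Z]) auto
qed

end


section \<open>Dissipative integral equations\<close>

text \<open>Since \<open>(norm (z t))\<^sup>2\<close> has derivative
  \<open>2 * inner (z t) (G t)\<close>, the dissipativity bound makes \<open>h\<close>, the energy
  minus its level \<open>d / a\<close> times the integrating factor \<open>exp (2 * a * t)\<close>,
  nonincreasing.\<close>

lemma dissipative_energy_bound:
  fixes z G :: "real \<Rightarrow> 'a::{real_inner, banach}"
  assumes T: "0 \<le> T" and a: "0 < a"
    and G: "continuous_on {0..T} G"
    and z: "\<And>t. t \<in> {0..T} \<Longrightarrow> z t = z0 + integral {0..t} G"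
    and diss: "\<And>t. t \<in> {0..T} \<Longrightarrow> inner (z t) (G t) \<le> - a * (norm (z t))\<^sup>2 + d"
  shows "(norm (z T))\<^sup>2 - d / a \<le> exp (- 2 * a * T) * ((norm z0)\<^sup>2 - d / a)"
proof -
  define h where "h t = exp (2 * a * t) * (inner (z t) (z t) - d / a)" for t
  have z': "(z has_vector_derivative G t) (at t within {0..T})" if t: "t \<in> {0..T}" for t
  proof -
    have "((\<lambda>t. z0 + integral {0..t} G) has_vector_derivative 0 + G t) (at t within {0..T})"
      by (intro has_vector_derivative_add has_vector_derivative_const integral_has_vector_derivative G t)
    then have "((\<lambda>t. z0 + integral {0..t} G) has_vector_derivative G t) (at t within {0..T})"
      by simp
    then show ?thesis by (rule has_vector_derivative_transform[OF t, rotated]) (rule z)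
  qed
  define h' where "h' t = exp (2 * a * t) * (2 * a * (inner (z t) (z t) - d / a) + 2 * inner (z t) (G t))" for t
  have h': "(h has_real_derivative h' t) (at t within {0..T})" if t: "t \<in> {0..T}" for t
  proof -
    have "((\<lambda>t. inner (z t) (z t)) has_real_derivative inner (z t) (G t) + inner (G t) (z t)) (at t within {0..T})"
      unfolding has_real_derivative_iff_has_vector_derivative
      by (intro bounded_bilinear.has_vector_derivative[OF bounded_bilinear_inner] z' t)
    from DERIV_diff[OF this DERIV_const[of "d / a"]]
    have 1: "((\<lambda>t. inner (z t) (z t) - d / a) has_real_derivative 2 * inner (z t) (G t)) (at t within {0..T})"
      by (simp add: inner_commute)
    have 2: "((\<lambda>t. exp (2 * a * t)) has_real_derivative exp (2 * a * t) * (2 * a)) (at t within {0..T})"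
      by (auto intro!: derivative_eq_intros)
    show ?thesis
      unfolding h_def[abs_def] h'_def by (rule DERIV_cong[OF DERIV_mult[OF 2 1]]) (simp only: algebra_simps)
  qed
  have "h T \<le> h 0"
  proof (rule DERIV_nonpos_imp_decreasing_open[OF T])
    show "continuous_on {0..T} h"
      by (rule DERIV_continuous_on[OF h'])
    fix t assume t: "0 < t" "t < T"
    have "(h has_real_derivative h' t) (at t)"
      using h'[of t] t by (simp add: at_within_Icc_at)
    moreover have "h' t \<le> 0"
    proof -
      have "2 * a * (inner (z t) (z t) - d / a) + 2 * inner (z t) (G t) \<le> 0"
        using diss[of t] t a by (simp add: power2_norm_eq_inner right_diff_distrib)
      then show ?thesis by (simp add: h'_def mult_nonneg_nonpos)
    qed
    ultimately show "\<exists>y. (h has_real_derivative y) (at t) \<and> y \<le> 0" by blast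
  qed
  moreover have "z 0 = z0" using z[of 0] T by simp
  ultimately have "exp (2 * a * T) * ((norm (z T))\<^sup>2 - d / a) \<le> (norm z0)\<^sup>2 - d / a"
    by (simp add: h_def power2_norm_eq_inner)
  then have "exp (- 2 * a * T) * (exp (2 * a * T) * ((norm (z T))\<^sup>2 - d / a)) \<le> exp (- 2 * a * T) * ((norm z0)\<^sup>2 - d / a)"
    by (rule mult_left_mono) simp
  moreover have "exp (- 2 * a * T) * exp (2 * a * T) = 1"
    unfolding exp_add[symmetric] by simp
  ultimately show ?thesis by (simp only: mult.assoc[symmetric] mult_1_left)
qed

text \<open>The common forcing \<open>W\<close> cancels in the difference of the two solutions,
  which is therefore differentiable; the energy bound applies with \<open>d = 0\<close>.\<close>

lemma dissipative_equation_contraction: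
  fixes F :: "'a::{real_inner, banach} \<Rightarrow> 'a"
  assumes F: "continuous_on UNIV F" and c: "0 < c"
    and diss: "\<And>x y. inner (x - y) (F x - F y) \<le> - c * (norm (x - y))\<^sup>2"
    and u: "continuous_on {0..} u" "\<And>t. 0 \<le> t \<Longrightarrow> u t = u0 + integral {0..t} (\<lambda>s. F (u s)) + W t"
    and v: "continuous_on {0..} v" "\<And>t. 0 \<le> t \<Longrightarrow> v t = v0 + integral {0..t} (\<lambda>s. F (v s)) + W t"
    and T: "0 \<le> T"
  shows "norm (u T - v T) \<le> exp (- c * T) * norm (u0 - v0)"
proof -
  have Fu: "continuous_on {0..t} (\<lambda>s. F (u s))" and Fv: "continuous_on {0..t} (\<lambda>s. F (v s))" for t
    by (rule continuous_on_compose2[OF F continuous_on_subset[OF u(1)]]; force)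
      (rule continuous_on_compose2[OF F continuous_on_subset[OF v(1)]]; force)
  have "(norm (u T - v T))\<^sup>2 - 0 / c \<le> exp (- 2 * c * T) * ((norm (u0 - v0))\<^sup>2 - 0 / c)"
  proof (rule dissipative_energy_bound[OF T c])
    show "continuous_on {0..T} (\<lambda>s. F (u s) - F (v s))"
      by (intro continuous_on_diff Fu Fv)
    fix t assume t: "t \<in> {0..T}"
    show "u t - v t = u0 - v0 + integral {0..t} (\<lambda>s. F (u s) - F (v s))"
      using t u(2)[of t] v(2)[of t] by (simp add: integral_diff integrable_continuous_interval Fu Fv)
    show "inner (u t - v t) (F (u t) - F (v t)) \<le> - c * (norm (u t - v t))\<^sup>2 + 0"
      using diss by simp
  qed
  also have "exp (- 2 * c * T) = (exp (- c * T))\<^sup>2"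
    by (simp add: power2_eq_square exp_add[symmetric])
  finally have "(norm (u T - v T))\<^sup>2 \<le> (exp (- c * T) * norm (u0 - v0))\<^sup>2"
    by (simp add: power_mult_distrib)
  then show ?thesis by (rule power2_le_imp_le) simp
qed

text \<open>The difference of the solution and the noise is differentiable and starts at zero.\<close>

lemma dissipative_equation_bound:
  fixes F :: "'a::{real_inner, banach} \<Rightarrow> 'a" and T :: real
  assumes F: "continuous_on UNIV F" and c: "0 < c"
    and diss: "\<And>x y. inner (x - y) (F x - F y) \<le> - c * (norm (x - y))\<^sup>2"
    and u: "continuous_on {0..} u" "\<And>t. 0 \<le> t \<Longrightarrow> u t = integral {0..t} (\<lambda>s. F (u s)) + W t"
    and T: "0 \<le> T"
    and W: "\<And>t. t \<in> {0..T} \<Longrightarrow> norm (F (W t)) \<le> b"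
  shows "norm (u T) \<le> norm (W T) + b / c"
proof -
  have b: "0 \<le> b" by (rule order_trans[OF norm_ge_zero W[of 0]]) (use T in simp)
  \<comment> \<open>Half of the dissipation absorbs the forcing, hence \<open>a = c / 2\<close> and
    \<open>d = b\<^sup>2 / (2 * c)\<close>, for which \<open>d / a\<close> is the square of
    \<open>b / c\<close>.\<close>
  have "(norm (u T - W T))\<^sup>2 - b\<^sup>2 / (2 * c) / (c / 2)
      \<le> exp (- 2 * (c / 2) * T) * ((norm (0 :: 'a))\<^sup>2 - b\<^sup>2 / (2 * c) / (c / 2))"
  proof (rule dissipative_energy_bound[OF T])
    show "continuous_on {0..T} (\<lambda>s. F (u s))"
      by (rule continuous_on_compose2[OF F continuous_on_subset[OF u(1)]]) auto
    fix t assume t: "t \<in> {0..T}"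
    show "u t - W t = 0 + integral {0..t} (\<lambda>s. F (u s))"
      using u(2)[of t] t by simp
    define z where "z = u t - W t"
    have "inner z (F (u t)) = inner (u t - W t) (F (u t) - F (W t)) + inner z (F (W t))"
      by (simp add: z_def inner_diff_right)
    also have "\<dots> \<le> - c * (norm z)\<^sup>2 + norm z * b"
      using diss[of "u t" "W t"] norm_cauchy_schwarz[of z "F (W t)"]
        mult_left_mono[OF W[OF t] norm_ge_zero[of z]] by (simp add: z_def)
    also have "norm z * b \<le> c / 2 * (norm z)\<^sup>2 + b\<^sup>2 / (2 * c)"
    proof -
      have "0 \<le> (c * norm z - b)\<^sup>2" by simp
      then have "2 * c * (norm z * b) \<le> c\<^sup>2 * (norm z)\<^sup>2 + b\<^sup>2"
        by (simp add: power2_eq_square algebra_simps)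
      then show ?thesis using c by (simp add: field_simps power2_eq_square)
    qed
    finally show "inner (u t - W t) (F (u t)) \<le> - (c / 2) * (norm (u t - W t))\<^sup>2 + b\<^sup>2 / (2 * c)"
      by (simp add: z_def)
  qed (use c in simp)
  \<comment> \<open>The initial energy is zero, below the level \<open>d / a\<close>, so the
    right-hand side is not positive.\<close>
  also have "\<dots> \<le> 0" using c b by (simp add: mult_nonneg_nonpos)
  finally have "(norm (u T - W T))\<^sup>2 \<le> (b / c)\<^sup>2"
    using c by (simp add: power2_eq_square)
  then have "norm (u T - W T) \<le> b / c"
    by (rule power2_le_imp_le) (use b c in simp)
  then show ?thesis using norm_triangle_sub[of "u T" "W T"] by simp
qed


section \<open>The lattice vector field\<close>

instance ell2 :: banach ..

text \<open>Writing \<open>lattice_A\<close> as twice the identity minus two shifts reduces its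
  boundedness and positivity to the fact that shifts are isometries.\<close>

lift_definition ell2_shift :: "int \<Rightarrow> ell2 \<Rightarrow> ell2" is "\<lambda>k x i. x (i + k)"
  by (rule summable_on_shift_int)

lemma norm_ell2_shift: "norm (ell2_shift k x) = norm x"
proof -
  have "bij_betw (\<lambda>i. i + k) UNIV (UNIV :: int set)"
    by (rule bij_betw_byWitness[where f' = "\<lambda>i. i - k"]) auto
  from infsum_reindex_bij_betw[OF this, of "\<lambda>i. (ell2_nth x i)\<^sup>2"]
  have "(norm (ell2_shift k x))\<^sup>2 = (norm x)\<^sup>2"
    by (simp add: ell2_power2_norm ell2_shift.rep_eq)
  then show ?thesis by simp
qed

lemma lattice_A_conv_shift: "lattice_A x = 2 *\<^sub>R x - ell2_shift (- 1) x - ell2_shift 1 x"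
  by (rule ell2_eqI) (simp add: lattice_A.rep_eq minus_ell2.rep_eq scaleR_ell2.rep_eq ell2_shift.rep_eq)

lemma norm_lattice_A_le: "norm (lattice_A x) \<le> 4 * norm x"
proof -
  have "norm (lattice_A x) \<le> norm (2 *\<^sub>R x - ell2_shift (- 1) x) + norm (ell2_shift 1 x)"
    unfolding lattice_A_conv_shift by (rule norm_triangle_ineq4)
  also have "norm (2 *\<^sub>R x - ell2_shift (- 1) x) \<le> norm (2 *\<^sub>R x) + norm (ell2_shift (- 1) x)"
    by (rule norm_triangle_ineq4)
  finally show ?thesis by (simp add: norm_ell2_shift)
qed

lemma bounded_linear_lattice_A: "bounded_linear lattice_A"
proof (rule bounded_linear_intro)
  show "lattice_A (x + y) = lattice_A x + lattice_A y" for x y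
    by (rule ell2_eqI) (simp add: lattice_A.rep_eq plus_ell2.rep_eq)
  show "lattice_A (r *\<^sub>R x) = r *\<^sub>R lattice_A x" for r x
    by (rule ell2_eqI) (simp add: lattice_A.rep_eq scaleR_ell2.rep_eq algebra_simps)
  show "norm (lattice_A x) \<le> norm x * 4" for x
    using norm_lattice_A_le[of x] by simp
qed

text \<open>Cauchy-Schwarz bounds each of the two shift terms by \<open>(norm x)\<^sup>2\<close>,
  and the diagonal term is twice that.\<close>

lemma inner_lattice_A_nonneg: "0 \<le> inner x (lattice_A x)"
proof -
  have "inner x (ell2_shift k x) \<le> (norm x)\<^sup>2" for k
    using norm_cauchy_schwarz[of x "ell2_shift k x"] by (simp add: norm_ell2_shift power2_eq_square)
  from this[of 1] this[of "- 1"] show ?thesis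
    by (simp add: lattice_A_conv_shift inner_diff_right power2_norm_eq_inner[symmetric])
qed

lemma lattice_field_dissipative:
  assumes "0 \<le> \<kappa>"
    and "inner (x - y) (f x - f y) \<le> - L * (norm (x - y))\<^sup>2"
  shows "inner (x - y) ((- \<kappa> *\<^sub>R lattice_A x - \<mu> *\<^sub>R x + f x + g) - (- \<kappa> *\<^sub>R lattice_A y - \<mu> *\<^sub>R y + f y + g))
    \<le> - (\<mu> + L) * (norm (x - y))\<^sup>2"
proof -
  have "(- \<kappa> *\<^sub>R lattice_A x - \<mu> *\<^sub>R x + f x + g) - (- \<kappa> *\<^sub>R lattice_A y - \<mu> *\<^sub>R y + f y + g)
      = - \<kappa> *\<^sub>R lattice_A (x - y) - \<mu> *\<^sub>R (x - y) + (f x - f y)"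
    by (simp add: linear_diff[OF bounded_linear.linear[OF bounded_linear_lattice_A]] scaleR_diff_right)
  then have "inner (x - y) ((- \<kappa> *\<^sub>R lattice_A x - \<mu> *\<^sub>R x + f x + g) - (- \<kappa> *\<^sub>R lattice_A y - \<mu> *\<^sub>R y + f y + g))
      = - \<kappa> * inner (x - y) (lattice_A (x - y)) - \<mu> * (norm (x - y))\<^sup>2 + inner (x - y) (f x - f y)"
    by (simp only: inner_add_right inner_diff_right inner_scaleR_right power2_norm_eq_inner)
  also have "\<dots> \<le> - (\<mu> + L) * (norm (x - y))\<^sup>2"
    using assms mult_nonneg_nonneg[OF assms(1) inner_lattice_A_nonneg[of "x - y"]]
    by (simp add: algebra_simps)
  finally show ?thesis .
qed

text \<open>With \<open>y \<ge> 1\<close> and \<open>p \<ge> 1\<close>, the power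
  \<open>y powr p\<close> dominates constant, linear and polynomial terms alike. The 4 is the bound
  for \<open>lattice_A\<close>, and the 2 comes from
  \<open>1 + norm x powr p \<le> 2 * y powr p\<close>.\<close>

lemma lattice_field_growth:
  assumes pos: "0 \<le> \<kappa>" "0 \<le> \<mu>" "0 \<le> K" "1 \<le> p"
    and f: "norm (f x) \<le> K * (1 + norm x powr p)"
    and y: "norm x \<le> y" "1 \<le> y"
  shows "norm (- \<kappa> *\<^sub>R lattice_A x - \<mu> *\<^sub>R x + f x + g) \<le> (4 * \<kappa> + \<mu> + 2 * K + norm g) * y powr p"
proof -
  have yp: "1 \<le> y powr p" using y pos by (simp add: ge_one_powr_ge_zero)
  have "y powr 1 \<le> y powr p" using y(2) pos(4) by (intro powr_mono) auto
  then have xy: "norm x \<le> y powr p" using y by simp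
  have xp: "norm x powr p \<le> y powr p" using y pos by (intro powr_mono2) auto
  have "norm (- \<kappa> *\<^sub>R lattice_A x - \<mu> *\<^sub>R x + f x + g)
      \<le> \<kappa> * norm (lattice_A x) + \<mu> * norm x + norm (f x) + norm g"
    using norm_triangle_ineq[of "- \<kappa> *\<^sub>R lattice_A x - \<mu> *\<^sub>R x + f x" g]
      norm_triangle_ineq[of "- \<kappa> *\<^sub>R lattice_A x - \<mu> *\<^sub>R x" "f x"]
      norm_triangle_ineq4[of "- \<kappa> *\<^sub>R lattice_A x" "\<mu> *\<^sub>R x"] pos by simp
  also have "\<dots> \<le> \<kappa> * (4 * y powr p) + \<mu> * y powr p + K * (2 * y powr p) + norm g * y powr p"
  proof (intro add_mono mult_left_mono pos)
    show "norm (lattice_A x) \<le> 4 * y powr p" using norm_lattice_A_le[of x] xy by simp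
    have "K * (1 + norm x powr p) \<le> K * (2 * y powr p)"
      using xp yp pos by (intro mult_left_mono) auto
    with f show "norm (f x) \<le> K * (2 * y powr p)" by simp
    show "norm g \<le> norm g * y powr p" using yp by (simp add: mult_le_cancel_left1)
  qed (rule xy)
  finally show ?thesis by (simp add: algebra_simps)
qed

section \<open>Shifted noise and its subexponential growth\<close>

lemma noise_wiener_shift:
  assumes "\<And>t. (\<lambda>i. (ell2_nth \<sigma> i * \<omega> t i) *\<^sub>R ell2_unit i) summable_on UNIV"
  shows "noise \<sigma> s (wiener_shift t \<omega>) = noise \<sigma> (s + t) \<omega> - noise \<sigma> t \<omega>"
  \<comment> \<open>Summability at both times is what allows the sum to be split, as
    \<open>infsum\<close> defaults to 0 on a family that is not summable.\<close>
  using infsum_add[OF assms[of "s + t"] summable_on_uminus[THEN iffD2, OF assms[of t]]]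
  by (simp add: noise_def wiener_shift_def right_diff_distrib scaleR_diff_left infsum_uminus)

text \<open>The quadratic Taylor term of \<open>exp (e * t)\<close> dominates
  \<open>t\<^sup>2\<close> after scaling by \<open>2 / e\<^sup>2\<close>, and the remaining 1 is
  below \<open>exp (e * t)\<close>.\<close>

lemma one_plus_square_le_exp:
  fixes e t :: real
  assumes "0 < e" "0 \<le> t"
  shows "1 + t\<^sup>2 \<le> (1 + 2 / e\<^sup>2) * exp (e * t)"
proof -
  have "1 + e * t + (e * t)\<^sup>2 / 2 \<le> exp (e * t)"
    using assms by (intro exp_lower_Taylor_quadratic) simp
  moreover have "0 \<le> e * t" using assms by simp
  ultimately have "1 \<le> exp (e * t)" "(e * t)\<^sup>2 / 2 \<le> exp (e * t)" by (auto simp: field_simps)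
  then have "1 + 2 / e\<^sup>2 * ((e * t)\<^sup>2 / 2) \<le> exp (e * t) + 2 / e\<^sup>2 * exp (e * t)"
    by (intro add_mono mult_left_mono) auto
  moreover have "2 / e\<^sup>2 * ((e * t)\<^sup>2 / 2) = t\<^sup>2"
    using assms by (simp add: power_mult_distrib)
  ultimately show ?thesis by (simp add: distrib_right)
qed

section \<open>Application to the lattice system\<close>

theorem theorem2:
  fixes H \<kappa> \<mu> L K p :: real
    and g \<sigma> :: ell2
    and fi :: "int \<Rightarrow> real \<Rightarrow> real"
    and f :: "ell2 \<Rightarrow> ell2"
    and Df :: "ell2 \<Rightarrow> ell2 \<Rightarrow>\<^sub>L ell2"
    and P :: "path measure"
    and \<Omega> :: "path set"
    and \<rho> :: "path \<Rightarrow> real"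
    and M :: "path measure"
    and \<phi> :: "real \<Rightarrow> path \<Rightarrow> ell2 \<Rightarrow> ell2"
  assumes H: "1/2 < H" "H < 1"
    and pos: "0 < \<kappa>" "0 < \<mu>"
    and fi_C1: "\<And>i. fi i C1_differentiable_on UNIV"
    and f: "\<And>x i. ell2_nth (f x) i = fi i (ell2_nth x i)"
    and Df: "\<And>x. (f has_derivative blinfun_apply (Df x)) (at x)"
    and constants: "0 < L" "0 < K" "1 \<le> p"
    and dissipative: "\<And>x y. inner (x - y) (f x - f y) \<le> - L * (norm (x - y))\<^sup>2"
    and growth: "\<And>x. norm (f x) + norm (Df x) \<le> K * (1 + norm x powr p)"
    and P: "canonical_fBm H P"
    and \<Omega>: "good_noise_set \<sigma> P \<Omega> \<rho>"
    and M: "M = restrict_space P \<Omega>"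
    and mds: "ergodic_mds M wiener_shift"
    and rds: "continuous_rds M wiener_shift \<phi>"
    and sol: "\<And>\<omega> u0 u. \<omega> \<in> \<Omega> \<Longrightarrow>
      pathwise_solution \<kappa> \<mu> f g \<sigma> \<omega> u0 u \<longleftrightarrow> (\<forall>t\<ge>0. u t = \<phi> t \<omega> u0)"
  shows "\<exists>A. random_attractor M wiener_shift \<phi> A \<and>
    (\<forall>B. random_attractor M wiener_shift \<phi> B \<longrightarrow> (AE \<omega> in M. B \<omega> = A \<omega>)) \<and>
    (\<exists>u0 \<in> borel_measurable M. \<forall>\<omega>\<in>\<Omega>. A \<omega> = {u0 \<omega>})"
proof -
  define c where "c = \<mu> + L"
  have c: "0 < c" using pos constants by (simp add: c_def)
  define F where "F x = - \<kappa> *\<^sub>R lattice_A x - \<mu> *\<^sub>R x + f x + g" for x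
  have "continuous_on UNIV f"
    using Df by (intro has_derivative_continuous_on) (auto simp: has_derivative_at_withinI)
  then have F_cont: "continuous_on UNIV F"
    unfolding F_def[abs_def]
    by (intro continuous_intros bounded_linear.continuous_on[OF bounded_linear_lattice_A])
  have F_diss: "inner (x - y) (F x - F y) \<le> - c * (norm (x - y))\<^sup>2" for x y
    unfolding F_def c_def using lattice_field_dissipative[where f = f, OF _ dissipative] pos by simp
  have space_M: "space M = \<Omega>"
  proof -
    have "\<Omega> \<subseteq> space P" using \<Omega> sets.sets_into_space by (auto simp: good_noise_set_def)
    then show ?thesis by (auto simp: M space_restrict_space)
  qed
  have shift: "wiener_shift t \<omega> \<in> \<Omega>" if "\<omega> \<in> \<Omega>" for t \<omega>
    using \<Omega> that by (simp add: good_noise_set_def)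
  \<comment> \<open>Taking the trajectory itself for \<open>u\<close> makes the right side of
    \<open>sol\<close> trivially true, so it yields continuity and the integral equation.\<close>
  have phi_cont: "continuous_on {0..} (\<lambda>t. \<phi> t \<omega> x)"
    and phi_eq: "\<And>t. 0 \<le> t \<Longrightarrow> \<phi> t \<omega> x = x + integral {0..t} (\<lambda>s. F (\<phi> s \<omega> x)) + noise \<sigma> t \<omega>"
    if "\<omega> \<in> \<Omega>" for \<omega> x
    using sol[OF that, of x "\<lambda>t. \<phi> t \<omega> x"] by (simp_all add: pathwise_solution_def F_def)

  interpret contracting_rds M wiener_shift \<phi> c
  proof
    show "metric_dynamical_system M wiener_shift" using mds by (simp add: ergodic_mds_def)
    show "continuous_rds M wiener_shift \<phi>" by (rule rds)
    show "0 < c" by (rule c)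
    show "norm (\<phi> t \<omega> x - \<phi> t \<omega> y) \<le> exp (- c * t) * norm (x - y)"
      if "0 \<le> t" "\<omega> \<in> space M" for t \<omega> x y
      by (rule dissipative_equation_contraction[OF F_cont c F_diss phi_cont phi_eq phi_cont phi_eq])
        (use that space_M in auto)
    fix \<omega> assume "\<omega> \<in> space M"
    then have \<omega>: "\<omega> \<in> \<Omega>" by (simp add: space_M)
    have \<rho>: "0 < \<rho> \<omega>" and W_bound: "\<And>t. norm (noise \<sigma> t \<omega>) \<le> \<rho> \<omega> * (1 + \<bar>t\<bar>\<^sup>2)"
      and W_sum: "\<And>t. (\<lambda>i. (ell2_nth \<sigma> i * \<omega> t i) *\<^sub>R ell2_unit i) summable_on UNIV"
      using \<Omega> \<omega> by (auto simp: good_noise_set_def)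
    \<comment> \<open>The noise is bounded at rate \<open>e\<close>; raising that bound to the power
      \<open>p\<close> gives exactly the rate \<open>c / 2\<close> demanded of the cocycle.\<close>
    define e where "e = c / (2 * p)"
    have e: "0 < e" "e * p = c / 2" using c constants by (auto simp: e_def)
    \<comment> \<open>The factor \<open>2 * \<rho> \<omega>\<close> accounts for the two noise
      values in a shifted path; the maximum with 1 ensures \<open>y \<ge> 1\<close> below.\<close>
    define R where "R = max 1 (2 * \<rho> \<omega> * (1 + 2 / e\<^sup>2))"
    have R: "1 \<le> R" by (simp add: R_def)
    define C where "C = 4 * \<kappa> + \<mu> + 2 * K + norm g"
    show "\<exists>B. \<forall>t\<ge>0. \<forall>s\<ge>0. norm (\<phi> t (wiener_shift (- s) \<omega>) 0) \<le> B * exp (c / 2 * (t + s))"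
    proof (intro exI allI impI)
      fix t s :: real assume t: "0 \<le> t" and s: "0 \<le> s"
      define \<omega>' where "\<omega>' = wiener_shift (- s) \<omega>"
      have \<omega>': "\<omega>' \<in> \<Omega>" by (simp add: \<omega>'_def shift \<omega>)
      define y where "y = R * exp (e * (t + s))"
      have y: "1 \<le> y"
        unfolding y_def using R e(1) t s mult_mono[of 1 R 1 "exp (e * (t + s))"] by simp
      have yp: "y powr p = R powr p * exp (c / 2 * (t + s))"
      proof -
        have "e * (t + s) * p = e * p * (t + s)" by simp
        then show ?thesis
          unfolding y_def using R e(2) by (simp add: powr_mult exp_powr_real)
      qed
      have W: "norm (noise \<sigma> r \<omega>') \<le> y" if r: "r \<in> {0..t}" for r
      proof -
        have sq: "norm (noise \<sigma> q \<omega>) \<le> \<rho> \<omega> * (1 + (t + s)\<^sup>2)" if "\<bar>q\<bar> \<le> t + s" for q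
        proof -
          have "\<bar>q\<bar>\<^sup>2 \<le> (t + s)\<^sup>2" using that by (intro power_mono) auto
          then have "\<rho> \<omega> * (1 + \<bar>q\<bar>\<^sup>2) \<le> \<rho> \<omega> * (1 + (t + s)\<^sup>2)"
            using \<rho> by (intro mult_left_mono) auto
          with W_bound[of q] show ?thesis by simp
        qed
        have "norm (noise \<sigma> r \<omega>') \<le> norm (noise \<sigma> (r + - s) \<omega>) + norm (noise \<sigma> (- s) \<omega>)"
          unfolding \<omega>'_def noise_wiener_shift[OF W_sum] by (rule norm_triangle_ineq4)
        also have "\<dots> \<le> 2 * \<rho> \<omega> * (1 + (t + s)\<^sup>2)"
        proof -
          have "\<bar>r + - s\<bar> \<le> t + s" "\<bar>- s\<bar> \<le> t + s" using r s by auto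
          from sq[OF this(1)] sq[OF this(2)] show ?thesis by simp
        qed
        also have "\<dots> \<le> 2 * \<rho> \<omega> * ((1 + 2 / e\<^sup>2) * exp (e * (t + s)))"
          using \<rho> t s e by (intro mult_left_mono one_plus_square_le_exp) auto
        also have "\<dots> = 2 * \<rho> \<omega> * (1 + 2 / e\<^sup>2) * exp (e * (t + s))" by simp
        also have "\<dots> \<le> y"
          unfolding y_def R_def by (intro mult_right_mono) auto
        finally show ?thesis .
      qed
      have f_bound: "norm (f x) \<le> K * (1 + norm x powr p)" for x
        using growth[of x] norm_ge_zero[of "Df x"] by linarith
      have FW: "norm (F (noise \<sigma> r \<omega>')) \<le> C * y powr p" if "r \<in> {0..t}" for r
        unfolding F_def C_def
        by (rule lattice_field_growth[where f = f, OF _ _ _ _ f_bound W[OF that] y]) (use pos constants in auto)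
      have "norm (\<phi> t \<omega>' 0) \<le> norm (noise \<sigma> t \<omega>') + C * y powr p / c"
        using phi_eq[OF \<omega>', of _ 0]
        by (intro dissipative_equation_bound[OF F_cont c F_diss phi_cont[OF \<omega>'] _ t FW]) simp_all
      \<comment> \<open>Raising to \<open>y powr p\<close>, possible since \<open>y \<ge> 1\<close>
        and \<open>p \<ge> 1\<close>, merges the noise with the drift term and produces the constant
        \<open>(1 + C / c) * R powr p\<close>.\<close>
      also have "norm (noise \<sigma> t \<omega>') \<le> y powr p"
        using W[of t] powr_mono[of 1 p y] constants y t by simp
      finally have "norm (\<phi> t \<omega>' 0) \<le> (1 + C / c) * y powr p"
        by (simp add: distrib_right)
      then show "norm (\<phi> t (wiener_shift (- s) \<omega>) 0)
          \<le> ((1 + C / c) * R powr p) * exp (c / 2 * (t + s))"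
        by (simp add: yp \<omega>'_def mult.assoc)
    qed
  qed
  show ?thesis
    using equilibrium_random_attractor random_attractor_unique equilibrium_measurable by blast
qed

end
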